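(* Let $p \in (1,\infty)$. There exists $C>0$ (independent of $u$ and $\sigma$) such that the following holds. Let $u \in L^{\infty}(\mathbb{B}_n)$. If $\sigma \in u^{\min(1,p-1)}B_p$, then $T_{u}$ acts boundedly on $L^p_{\sigma}$ with $$\|T_u\|_{L^p_{\sigma}\rightarrow L^p_{\sigma}}\leq C\, [\sigma]_{u^{\min(1,p-1)}B_p}^{\max\left(1,\frac{1}{p-1}\right)}.$$
   Context: $\mathbb{B}_n$ is the open unit ball of $\mathbb{C}^n$, $V$ is normalized Lebesgue measure on $\mathbb{B}_n$, $|A|=V(A)$, $z\overline{w}=\sum_{j=1}^n z_j\overline{w}_j$, $p'=p/(p-1)$. For $u\in L^\infty$ the Toeplitz operator is $T_uf(z)=\int_{\mathbb{B}_n}\frac{u(w)f(w)}{(1-z\overline{w})^{n+1}}\,dV(w)$. A weight is a locally integrable function on $\mathbb{B}_n$ that is positive almost everywhere; $\langle f\rangle_A=\frac{1}{|A|}\int_A f\,dV$; $L^p_\sigma$ has norm $\|f\|_{L^p_\sigma}^p=\int_{\mathbb{B}_n}|f|^p\sigma\,dV$. Dyadic structure. The Carleson tent over $z\in\mathbb{B}_n\setminus\{0\}$ is $\mathcal{T}_z=\{w\in\mathbb{B}_n: |1-\overline{w}\frac{z}{|z|}|<1-|z|\}$, and $\mathcal{T}_0=\mathbb{B}_n$. Let $\phi_z$ be the involutive automorphism of $\mathbb{B}_n$ interchanging $z$ and $0$, $\beta(z,w)=\frac12\log\frac{1+|\phi_z(w)|}{1-|\phi_z(w)|}$ the Bergman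 metric, and $B_\beta(z,s)$ its balls. Fix $\theta_0,\lambda_0>0$. For $k\geq1$ let $\mathbb{S}_{k\theta_0}=\{z:\beta(0,z)=k\theta_0\}$, and choose points $w_j^k$ and Borel sets $Q_j^k\subseteq\mathbb{S}_{k\theta_0}$ containing $w_j^k$ ($1\le j\le J_k$), pairwise disjoint for fixed $k$, with union $\mathbb{S}_{k\theta_0}$, and such that $\mathbb{S}_{k\theta_0}\cap B_\beta(w_j^k,\lambda_0)\subseteq Q_j^k\subseteq\mathbb{S}_{k\theta_0}\cap B_\beta(w_j^k,C_0\lambda_0)$ for a constant $C_0>1$. Let $P_{s}z$ be the radial projection of $z$ onto $\{\beta(0,\cdot)=s\}$. The kubes are $K_1^0=B_\beta(0,\theta_0)$ and $K_j^k=\{z: k\theta_0<\beta(0,z)\le(k+1)\theta_0,\ P_{k\theta_0}z\in Q_j^k\}$, $k\geq1$; the center of $K_j^k$ is $c_j^k=P_{(k+\frac12)\theta_0}w_j^k$ and its generation is $k$. For $k_1>k_2\ge1$, $K_{j_1}^{k_1}$ is a descendant of $K_{j_2}^{k_2}$ if $P_{k_2\theta_0}c_{j_1}^{k_1}\in Q_{j_2}^{k_2}$ (a child if $k_1=k_2+1$); all kubes of generation $\ge 1$ are descendants of $K_1^0$, those of generation 1 being its children. The dyadic tent $\widehat{K}$ is the union of $K$ and all its descendants. A dyadic structure is the collection of kubes so obtained. One fixes a finite collection $\mathcal{D}_1,\dots,\mathcal{D}_M$ of such structures so that, in each $\mathcal{D}_\ell$, two tents are either disjoint or nested and $|K|\approx|\widehat{K}|\approx(1-|c_K|^2)^{n+1}$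 uniformly, and so that every Carleson tent is contained in some tent $\widehat{K}$ of comparable measure, and every $\widehat{K}$ is contained in some Carleson tent of comparable measure. Put $\mathcal{D}=\bigcup_{\ell=1}^M\mathcal{D}_\ell$. For $s>0$, a weight $\sigma$ is in $u^sB_p$ if $[\sigma]_{u^sB_p}=\sup_{K\in\mathcal{D}}\|u\|_{L^\infty(\widehat{K})}^s\langle\sigma\rangle_{\widehat{K}}\langle\sigma^{1-p'}\rangle_{\widehat{K}}^{p-1}<\infty$. *)

theory Defs
  imports "HOL-Analysis.Analysis" "HOL-Probability.Essential_Supremum"
begin

section \<open>The unit ball and its Bergman metric\<close>

abbreviation unit_ball :: "(complex ^ 'n::finite) set" where
  "unit_ball \<equiv> ball 0 1"

text \<open>Normalized Lebesgue measure; its space is the ball itself, so measurability and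
  almost-everywhere statements only concern values on the ball.\<close>

definition Vol :: "(complex ^ 'n::finite) measure" where
  "Vol = uniform_measure (lebesgue_on unit_ball) unit_ball"

definition hdot :: "complex ^ 'n \<Rightarrow> complex ^ 'n::finite \<Rightarrow> complex" where
  "hdot z w = (\<Sum>j\<in>UNIV. z $ j * cnj (w $ j))"

text \<open>The involutive automorphism of the ball interchanging \<open>z\<close> and \<open>0\<close>, given by the usual
  formula in terms of the orthogonal projection of \<open>w\<close> onto the complex line through \<open>z\<close>.\<close>

definition line_proj :: "complex ^ 'n \<Rightarrow> complex ^ 'n \<Rightarrow> complex ^ 'n::finite" where
  "line_proj z w = (hdot w z / hdot z z) *s z"

definition phi :: "complex ^ 'n \<Rightarrow> complex ^ 'n \<Rightarrow> complex ^ 'n::finite" where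
  "phi z w =
     (if z = 0 then - w
      else (1 / (1 - hdot w z)) *s
             (z - line_proj z w - sqrt (1 - (norm z)\<^sup>2) *\<^sub>R (w - line_proj z w)))"

definition bergman_dist :: "complex ^ 'n \<Rightarrow> complex ^ 'n::finite \<Rightarrow> real" where
  "bergman_dist z w = 1 / 2 * ln ((1 + norm (phi z w)) / (1 - norm (phi z w)))"

text \<open>Closed balls. With open balls the root kube below would miss the sphere at distance
  \<open>\<theta>\<close> from the origin, which belongs to no kube of generation \<open>\<ge> 1\<close> either; the kubes would
  then not cover the unit ball, and the Carleson tent over \<open>0\<close> would lie in no dyadic tent.
  For the cells of the spheres the choice only amounts to rescaling \<open>lam\<close> and \<open>C0\<close>.\<close>

definition bergman_ball :: "complex ^ 'n \<Rightarrow> real \<Rightarrow> (complex ^ 'n::finite) set" where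
  "bergman_ball z s = {w \<in> unit_ball. bergman_dist z w \<le> s}"

definition bergman_sphere :: "real \<Rightarrow> (complex ^ 'n::finite) set" where
  "bergman_sphere s = {z \<in> unit_ball. bergman_dist 0 z = s}"

text \<open>Radial projection onto the Bergman sphere of radius \<open>s\<close> about the origin. The Euclidean
  radius of that sphere is \<open>tanh s\<close>, see \<open>radial_proj_in_sphere\<close>.\<close>

definition radial_proj :: "real \<Rightarrow> complex ^ 'n \<Rightarrow> complex ^ 'n::finite" where
  "radial_proj s z = (tanh s / norm z) *\<^sub>R z"

lemma bergman_dist_0: "bergman_dist 0 w = artanh (norm w)"
  by (simp add: bergman_dist_def phi_def artanh_def)

lemma radial_proj_in_sphere:
  assumes "z \<noteq> 0" "0 \<le> s"
  shows "radial_proj s z \<in> bergman_sphere s"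
proof -
  have "norm (radial_proj s z) = tanh s"
    using assms by (simp add: radial_proj_def)
  then show ?thesis
    by (simp add: bergman_sphere_def bergman_dist_0 artanh_tanh_real tanh_real_lt_1)
qed

lemma hdot_self: "hdot z z = of_real ((norm z)\<^sup>2)"
  by (simp add: hdot_def norm_vec_def L2_set_def sum_nonneg flip: complex_norm_square)

lemma phi_0: "phi z 0 = z"
  by (simp add: phi_def line_proj_def hdot_def)

lemma phi_self: "phi z z = 0"
  by (simp add: phi_def line_proj_def hdot_self)

definition carleson_tent :: "complex ^ 'n \<Rightarrow> (complex ^ 'n::finite) set" where
  "carleson_tent z =
     (if z = 0 then unit_ball
      else {w \<in> unit_ball. cmod (1 - hdot ((1 / norm z) *\<^sub>R z) w) < 1 - norm z})"


section \<open>Dyadic structures\<close>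

text \<open>\<open>num k\<close>, \<open>pt k j\<close> and \<open>cell k j\<close> are \<open>J\<^sub>k\<close>, \<open>w\<^sub>j\<^sup>k\<close> and \<open>Q\<^sub>j\<^sup>k\<close>; only \<open>k \<ge> 1\<close> and
  \<open>1 \<le> j \<le> num k\<close> are meaningful.\<close>

record 'n dyadic =
  num :: "nat \<Rightarrow> nat"
  pt :: "nat \<Rightarrow> nat \<Rightarrow> complex ^ 'n"
  cell :: "nat \<Rightarrow> nat \<Rightarrow> (complex ^ 'n) set"

definition dyadic_structure :: "real \<Rightarrow> real \<Rightarrow> 'n::finite dyadic \<Rightarrow> bool" where
  "dyadic_structure \<theta> lam D \<longleftrightarrow>
     (\<exists>C0>1. \<forall>k\<ge>1.
        (\<forall>j\<in>{1..num D k}.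
           cell D k j \<in> sets borel \<and>
           pt D k j \<in> cell D k j \<and>
           bergman_sphere (real k * \<theta>) \<inter> bergman_ball (pt D k j) lam \<subseteq> cell D k j \<and>
           cell D k j \<subseteq> bergman_sphere (real k * \<theta>) \<inter> bergman_ball (pt D k j) (C0 * lam)) \<and>
        disjoint_family_on (cell D k) {1..num D k} \<and>
        (\<Union>j\<in>{1..num D k}. cell D k j) = bergman_sphere (real k * \<theta>))"

text \<open>Kubes are addressed by pairs (generation, number); the root is \<open>(0, 1)\<close>.\<close>

definition kubes :: "'n::finite dyadic \<Rightarrow> (nat \<times> nat) set" where
  "kubes D = insert (0, 1) {(k, j). 1 \<le> k \<and> j \<in> {1..num D k}}"

fun kube :: "real \<Rightarrow> 'n::finite dyadic \<Rightarrow> nat \<times> nat \<Rightarrow> (complex ^ 'n) set" where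
  "kube \<theta> D (k, j) =
     (if k = 0 then bergman_ball 0 \<theta>
      else {z \<in> unit_ball. real k * \<theta> < bergman_dist 0 z \<and> bergman_dist 0 z \<le> real (k + 1) * \<theta> \<and>
              radial_proj (real k * \<theta>) z \<in> cell D k j})"

text \<open>The center of the root is taken to be the origin.\<close>

fun center :: "real \<Rightarrow> 'n::finite dyadic \<Rightarrow> nat \<times> nat \<Rightarrow> complex ^ 'n" where
  "center \<theta> D (k, j) = (if k = 0 then 0 else radial_proj ((real k + 1 / 2) * \<theta>) (pt D k j))"

fun descendant :: "real \<Rightarrow> 'n::finite dyadic \<Rightarrow> nat \<times> nat \<Rightarrow> nat \<times> nat \<Rightarrow> bool" where
  "descendant \<theta> D (k1, j1) (k2, j2) \<longleftrightarrow>
     k2 < k1 \<and> (k2 = 0 \<or> radial_proj (real k2 * \<theta>) (center \<theta> D (k1, j1)) \<in> cell D k2 j2)"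

definition tent :: "real \<Rightarrow> 'n::finite dyadic \<Rightarrow> nat \<times> nat \<Rightarrow> (complex ^ 'n) set" where
  "tent \<theta> D K = kube \<theta> D K \<union> (\<Union>K'\<in>{K' \<in> kubes D. descendant \<theta> D K' K}. kube \<theta> D K')"

definition comparable :: "real \<Rightarrow> real \<Rightarrow> real \<Rightarrow> bool" where
  "comparable A x y \<longleftrightarrow> x \<le> A * y \<and> y \<le> A * x"

definition dyadic_collection ::
  "real \<Rightarrow> real \<Rightarrow> nat \<Rightarrow> (nat \<Rightarrow> 'n::finite dyadic) \<Rightarrow> bool" where
  "dyadic_collection \<theta> lam M D \<longleftrightarrow>
     (\<forall>l\<in>{1..M}. dyadic_structure \<theta> lam (D l)) \<and>
     (\<forall>l\<in>{1..M}. \<forall>K\<in>kubes (D l). \<forall>K'\<in>kubes (D l).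
        tent \<theta> (D l) K \<inter> tent \<theta> (D l) K' = {} \<or>
        tent \<theta> (D l) K \<subseteq> tent \<theta> (D l) K' \<or> tent \<theta> (D l) K' \<subseteq> tent \<theta> (D l) K) \<and>
     (\<exists>A>0. \<forall>l\<in>{1..M}. \<forall>K\<in>kubes (D l).
        comparable A (measure Vol (kube \<theta> (D l) K)) (measure Vol (tent \<theta> (D l) K)) \<and>
        comparable A (measure Vol (tent \<theta> (D l) K))
          ((1 - (norm (center \<theta> (D l) K))\<^sup>2) ^ (CARD('n) + 1))) \<and>
     (\<exists>A>0. \<forall>z\<in>unit_ball. \<exists>l\<in>{1..M}. \<exists>K\<in>kubes (D l).
        carleson_tent z \<subseteq> tent \<theta> (D l) K \<and>
        comparable A (measure Vol (tent \<theta> (D l) K)) (measure Vol (carleson_tent z))) \<and>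
     (\<exists>A>0. \<forall>l\<in>{1..M}. \<forall>K\<in>kubes (D l). \<exists>z\<in>unit_ball.
        tent \<theta> (D l) K \<subseteq> carleson_tent z \<and>
        comparable A (measure Vol (tent \<theta> (D l) K)) (measure Vol (carleson_tent z)))"


section \<open>Weights and function spaces\<close>

text \<open>Powers of extended nonnegative reals, used for positive exponents only.\<close>

definition ennpowr :: "ennreal \<Rightarrow> real \<Rightarrow> ennreal" where
  "ennpowr x a = (if x = \<infinity> then \<infinity> else ennreal (enn2real x powr a))"

definition weight :: "(complex ^ 'n::finite \<Rightarrow> real) \<Rightarrow> bool" where
  "weight \<sigma> \<longleftrightarrow>
     \<sigma> \<in> borel_measurable Vol \<and>
     (\<forall>S. compact S \<and> S \<subseteq> unit_ball \<longrightarrow> set_integrable Vol S \<sigma>) \<and>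
     (AE z in Vol. 0 < \<sigma> z)"

definition Linf_norm :: "(complex ^ 'n::finite) set \<Rightarrow> (complex ^ 'n \<Rightarrow> complex) \<Rightarrow> ennreal" where
  "Linf_norm A u = esssup (restrict_space Vol A) (\<lambda>z. ennreal (cmod (u z)))"

definition Linf :: "(complex ^ 'n::finite \<Rightarrow> complex) set" where
  "Linf = {u \<in> borel_measurable Vol. Linf_norm unit_ball u < \<infinity>}"

definition avg :: "(complex ^ 'n::finite) set \<Rightarrow> (complex ^ 'n \<Rightarrow> real) \<Rightarrow> ennreal" where
  "avg A f = (\<integral>\<^sup>+ z\<in>A. ennreal (f z) \<partial>Vol) / emeasure Vol A"

definition Lp_norm :: "real \<Rightarrow> (complex ^ 'n::finite \<Rightarrow> real) \<Rightarrow> (complex ^ 'n \<Rightarrow> complex) \<Rightarrow> ennreal" where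
  "Lp_norm p \<sigma> f = ennpowr (\<integral>\<^sup>+ z. ennreal (cmod (f z) powr p * \<sigma> z) \<partial>Vol) (1 / p)"

definition Lp :: "real \<Rightarrow> (complex ^ 'n::finite \<Rightarrow> real) \<Rightarrow> (complex ^ 'n \<Rightarrow> complex) set" where
  "Lp p \<sigma> = {f \<in> borel_measurable Vol. Lp_norm p \<sigma> f < \<infinity>}"

text \<open>The convention \<open>0 * \<infinity> = 0\<close> of \<^typ>\<open>ennreal\<close> only matters for \<open>u = 0\<close> a.e.: otherwise the
  finiteness of the term of a root kube, whose tent is the whole ball, makes the averages of
  \<open>\<sigma>\<close> and \<open>\<sigma> powr (1 - p')\<close> finite on every tent.\<close>

definition uB_char ::
  "real \<Rightarrow> nat \<Rightarrow> (nat \<Rightarrow> 'n::finite dyadic) \<Rightarrow> (complex ^ 'n \<Rightarrow> complex) \<Rightarrow> real \<Rightarrow> real \<Rightarrow>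
   (complex ^ 'n \<Rightarrow> real) \<Rightarrow> ennreal" where
  "uB_char \<theta> M D u s p \<sigma> =
     (let p' = p / (p - 1) in
      SUP (l, K) \<in> (SIGMA l:{1..M}. kubes (D l)).
        ennpowr (Linf_norm (tent \<theta> (D l) K) u) s *
        avg (tent \<theta> (D l) K) \<sigma> *
        ennpowr (avg (tent \<theta> (D l) K) (\<lambda>z. \<sigma> z powr (1 - p'))) (p - 1))"

definition uB ::
  "real \<Rightarrow> nat \<Rightarrow> (nat \<Rightarrow> 'n::finite dyadic) \<Rightarrow> (complex ^ 'n \<Rightarrow> complex) \<Rightarrow> real \<Rightarrow> real \<Rightarrow>
   (complex ^ 'n \<Rightarrow> real) set" where
  "uB \<theta> M D u s p = {\<sigma>. weight \<sigma> \<and> uB_char \<theta> M D u s p \<sigma> < \<infinity>}"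


section \<open>Toeplitz operators\<close>

definition toeplitz_integrand ::
  "(complex ^ 'n::finite \<Rightarrow> complex) \<Rightarrow> (complex ^ 'n \<Rightarrow> complex) \<Rightarrow> complex ^ 'n \<Rightarrow> complex ^ 'n \<Rightarrow> complex" where
  "toeplitz_integrand u f z w = u w * f w / (1 - hdot z w) ^ (CARD('n) + 1)"

definition toeplitz ::
  "(complex ^ 'n::finite \<Rightarrow> complex) \<Rightarrow> (complex ^ 'n \<Rightarrow> complex) \<Rightarrow> complex ^ 'n \<Rightarrow> complex" where
  "toeplitz u f z = (LINT w|Vol. toeplitz_integrand u f z w)"

text \<open>The Bochner integral of a non-integrable function is \<open>0\<close>, so convergence of the integral
  defining the operator on the whole space is a separate claim.\<close>

definition toeplitz_defined_on ::
  "(complex ^ 'n::finite \<Rightarrow> complex) \<Rightarrow> (complex ^ 'n \<Rightarrow> complex) set \<Rightarrow> bool" where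
  "toeplitz_defined_on u F \<longleftrightarrow>
     (\<forall>f\<in>F. \<forall>z\<in>unit_ball. integrable Vol (toeplitz_integrand u f z))"

definition op_norm ::
  "real \<Rightarrow> (complex ^ 'n::finite \<Rightarrow> real) \<Rightarrow> ((complex ^ 'n \<Rightarrow> complex) \<Rightarrow> complex ^ 'n \<Rightarrow> complex) \<Rightarrow> ennreal" where
  "op_norm p \<sigma> T = (SUP f\<in>{f \<in> Lp p \<sigma>. Lp_norm p \<sigma> f \<le> 1}. Lp_norm p \<sigma> (T f))"

definition bounded_on_Lp ::
  "real \<Rightarrow> (complex ^ 'n::finite \<Rightarrow> real) \<Rightarrow> ((complex ^ 'n \<Rightarrow> complex) \<Rightarrow> complex ^ 'n \<Rightarrow> complex) \<Rightarrow> bool" where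
  "bounded_on_Lp p \<sigma> T \<longleftrightarrow>
     (\<forall>f\<in>Lp p \<sigma>. T f \<in> Lp p \<sigma>) \<and>
     (\<forall>f\<in>Lp p \<sigma>. \<forall>g\<in>Lp p \<sigma>. \<forall>a b. AE z in Vol. T (\<lambda>w. a * f w + b * g w) z = a * T f z + b * T g z) \<and>
     op_norm p \<sigma> T < \<infinity>"

end

theory Submission
  imports Defs "HOL-Probability.Probability_Measure"
begin

text \<open>
  The Bergman kernel is controlled by dyadic tents: any two points \<open>z\<close>, \<open>w\<close> of the ball lie in a
  common Carleson tent whose volume is at most a constant times \<open>\<bar>1 - z w\<bar>^(n + 1)\<close>, hence in a
  common dyadic tent with the same property. Writing \<open>c K\<close> for the supremum of \<open>\<bar>u\<bar>\<close> on the tent over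
  \<open>K\<close>, this gives the pointwise estimate
  \<open>\<bar>T f\<bar> \<le> A (\<Sum>K. c K * (average of \<bar>f\<bar> on the tent) * indicator of the tent)\<close>
  for the Toeplitz operator \<open>T\<close> with symbol \<open>u\<close> (\<open>dyadic_collection_kernel\<close>,
  \<open>toeplitz_weighted_bound\<close>). It remains to bound this positive dyadic operator on \<open>L\<^sup>p(\<sigma>)\<close>, and the
  symbol enters only through the numbers \<open>c K\<close> that also occur in the characteristic of the weight.

  Let \<open>q = p / (p - 1)\<close> and \<open>\<tau> = \<sigma>^(1 - q)\<close>. By duality one has to estimate the sum over \<open>K\<close> of
  \<open>c K * (\<integral>f \<tau>) * (\<integral>g \<sigma>) / \<bar>tent\<bar>\<close>, the integrals being over the tent over \<open>K\<close>, for \<open>f \<in> L\<^sup>p(\<tau>)\<close> and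
  \<open>g \<in> L\<^sup>q(\<sigma>)\<close>. Let \<open>F\<close> and \<open>G\<close> be the averages of \<open>f\<close> and \<open>g\<close> over the tent with respect to \<open>\<tau>\<close> and
  \<open>\<sigma>\<close>, and let \<open>t\<close>, \<open>s\<close> be the averages of \<open>\<tau>\<close> and \<open>\<sigma>\<close> over the tent. If \<open>p \<ge> 2\<close>, the term is
  \<open>(c K * s * t^(p - 1)) * (t^(2 - p) * \<bar>tent\<bar>) * F * G\<close>.
  The first factor is bounded by the characteristic. In the second one the exponent \<open>2 - p\<close> is not
  positive, so the tent may be replaced by its kube, whose volume is comparable; and on the kube
  \<open>\<bar>K\<bar> \<le> \<sigma>(K)^(1/p) \<tau>(K)^(1/q)\<close>, which turns the second factor into a multiple of
  \<open>\<tau>(K)^(1/p) \<sigma>(K)^(1/q)\<close> (\<open>sparse_form_bound_ge_2\<close>). Since kubes are disjoint while tents are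
  nested or disjoint, Hoelder's inequality and the Carleson embedding theorem
  (\<open>carleson_embedding\<close>), applied in \<open>L\<^sup>p(\<tau>)\<close> and in \<open>L\<^sup>q(\<sigma>)\<close>, conclude. If \<open>p < 2\<close>, the roles of
  \<open>(p, \<sigma>)\<close> and \<open>(q, \<tau>)\<close> are exchanged: this requires a bound for \<open>c K * t * s^(q - 1)\<close>, which is
  the power \<open>q - 1 = 1 / (p - 1)\<close> of \<open>c K^(p - 1) * s * t^(p - 1)\<close>. This explains both exponents
  \<open>min 1 (p - 1)\<close> and \<open>max 1 (1 / (p - 1))\<close>.

  Only finite subfamilies of tents are used in the norm estimates; the operator itself is reached
  by monotone convergence.
\<close>


section \<open>Hoelder's inequality\<close>

lemma Holder_integral:
  fixes f g :: "'a \<Rightarrow> real"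
  assumes pq: "1 < p" "1 < q" "1 / p + 1 / q = 1"
    and [measurable]: "f \<in> borel_measurable M" "g \<in> borel_measurable M"
    and nonneg: "\<And>x. 0 \<le> f x" "\<And>x. 0 \<le> g x"
    and int: "integrable M (\<lambda>x. f x powr p)" "integrable M (\<lambda>x. g x powr q)"
  shows "integrable M (\<lambda>x. f x * g x)"
    and "(LINT x|M. f x * g x) \<le> (LINT x|M. f x powr p) powr (1 / p) * (LINT x|M. g x powr q) powr (1 / q)"
proof -
  have young: "f x * g x \<le> f x powr p / p + g x powr q / q" for x
    using Youngs_inequality[of p q "f x" "g x"] pq nonneg by simp
  show fg: "integrable M (\<lambda>x. f x * g x)"
  proof (rule Bochner_Integration.integrable_bound)
    show "integrable M (\<lambda>x. f x powr p / p + g x powr q / q)"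
      using int by auto
    show "AE x in M. norm (f x * g x) \<le> norm (f x powr p / p + g x powr q / q)"
      using young nonneg pq by (intro AE_I2) (auto intro: order_trans[OF young])
  qed auto
  define X Y where "X = (LINT x|M. f x powr p) powr (1 / p)" and "Y = (LINT x|M. g x powr q) powr (1 / q)"
  have XY: "0 \<le> X" "0 \<le> Y" by (auto simp: X_def Y_def)
  have Xp: "X powr p = (LINT x|M. f x powr p)" and Yq: "Y powr q = (LINT x|M. g x powr q)"
    using pq by (simp_all add: X_def Y_def powr_powr)
  \<comment> \<open>normalising by slightly more than the two norms spares the case of a vanishing norm\<close>
  have bound: "(LINT x|M. f x * g x) \<le> (X + e) * (Y + e)" if "0 < e" for e
  proof -
    have pos: "0 < X + e" "0 < Y + e" using XY that by auto
    have "f x * g x / ((X + e) * (Y + e)) \<le> f x powr p / (X + e) powr p / p + g x powr q / (Y + e) powr q / q" for x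
      using Youngs_inequality[of p q "f x / (X + e)" "g x / (Y + e)"] pq nonneg pos
      by (simp add: powr_divide)
    then have "(LINT x|M. f x * g x / ((X + e) * (Y + e)))
        \<le> (LINT x|M. f x powr p / (X + e) powr p / p + g x powr q / (Y + e) powr q / q)"
      using fg int by (intro integral_mono) auto
    also have "\<dots> = X powr p / (X + e) powr p / p + Y powr q / (Y + e) powr q / q"
      using int by (simp add: Xp Yq)
    also have "\<dots> \<le> 1 / p + 1 / q"
      using XY pos pq that by (intro add_mono divide_right_mono) (auto simp: divide_le_eq_1 intro!: powr_mono2)
    finally show ?thesis
      using pos pq by (simp add: divide_le_eq)
  qed
  have "((\<lambda>e. (X + e) * (Y + e)) \<longlongrightarrow> (X + 0) * (Y + 0)) (at_right 0)"
    by (intro tendsto_intros)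
  then show "(LINT x|M. f x * g x) \<le> X * Y"
    using tendsto_lowerbound[of _ _ "at_right (0::real)" "LINT x|M. f x * g x"] bound
    by (auto simp: eventually_at_filter)
qed

lemma Holder_sum:
  fixes f g :: "'a \<Rightarrow> real"
  assumes "1 < p" "1 < q" "1 / p + 1 / q = 1" "finite I"
    and nonneg: "\<And>i. i \<in> I \<Longrightarrow> 0 \<le> f i" "\<And>i. i \<in> I \<Longrightarrow> 0 \<le> g i"
  shows "(\<Sum>i\<in>I. f i * g i) \<le> (\<Sum>i\<in>I. f i powr p) powr (1 / p) * (\<Sum>i\<in>I. g i powr q) powr (1 / q)"
proof -
  have "(\<Sum>i\<in>I. max 0 (f i) * max 0 (g i)) \<le>
    (\<Sum>i\<in>I. max 0 (f i) powr p) powr (1 / p) * (\<Sum>i\<in>I. max 0 (g i) powr q) powr (1 / q)"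
    using Holder_integral(2)[OF assms(1-3), of "\<lambda>i. max 0 (f i)" "count_space I" "\<lambda>i. max 0 (g i)"] \<open>finite I\<close>
    by (simp add: lebesgue_integral_count_space_finite integrable_count_space)
  moreover have "max 0 (f i) = f i" "max 0 (g i) = g i" if "i \<in> I" for i
    using nonneg that by auto
  ultimately show ?thesis by simp
qed


section \<open>The Carleson embedding theorem for laminar families\<close>

lemma nn_integral_powr_from_0:
  fixes a c :: real
  assumes "- 1 < a" "0 \<le> c"
  shows "(\<integral>\<^sup>+t. ennreal (t powr a) * indicator {0..c} t \<partial>lborel) = ennreal (c powr (a + 1) / (a + 1))"
  using assms by (intro nn_integral_has_integral_lebesgue' has_integral_powr_from_0) auto

definition laminar :: "'a set set \<Rightarrow> bool" where
  "laminar \<T> \<longleftrightarrow> (\<forall>S\<in>\<T>. \<forall>S'\<in>\<T>. S \<inter> S' = {} \<or> S \<subseteq> S' \<or> S' \<subseteq> S)"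

lemma laminar_subset: "laminar \<T> \<Longrightarrow> \<S> \<subseteq> \<T> \<Longrightarrow> laminar \<S>"
  by (auto simp: laminar_def)

lemma laminar_disjoint_cover:
  assumes "finite \<T>" "laminar \<T>"
  obtains \<S> where "\<S> \<subseteq> \<T>" "disjoint \<S>" "\<Union>\<S> = \<Union>\<T>"
proof
  define \<S> where "\<S> = {S \<in> \<T>. \<forall>S'\<in>\<T>. S \<subseteq> S' \<longrightarrow> S = S'}"
  show "\<S> \<subseteq> \<T>" by (auto simp: \<S>_def)
  show "disjoint \<S>"
    unfolding disjoint_def
  proof (intro ballI impI)
    fix S S' assume "S \<in> \<S>" "S' \<in> \<S>" "S \<noteq> S'"
    then show "S \<inter> S' = {}"
      using assms(2) unfolding laminar_def \<S>_def by (smt (verit) mem_Collect_eq)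
  qed
  have "S \<subseteq> \<Union>\<S>" if S: "S \<in> \<T>" for S
  proof -
    obtain S' where "S' \<in> \<T>" "S \<subseteq> S'" "\<forall>R\<in>\<T>. S' \<subseteq> R \<longrightarrow> S' = R"
      using finite_has_maximal2[OF assms(1) S] by blast
    then show ?thesis by (auto simp: \<S>_def)
  qed
  then show "\<Union>\<S> = \<Union>\<T>" by (auto simp: \<S>_def)
qed

text \<open>
  The maximal members of the family are disjoint and cover the union. The part of \<open>g\<close> below \<open>t / 2\<close>
  accounts for at most half of each average, so it can be absorbed on the left; keeping only the
  values above \<open>t / 2\<close> is what makes the integration over \<open>t\<close> in the embedding theorem converge.
\<close>

lemma laminar_weak_type:
  fixes g :: "'a \<Rightarrow> real"
  assumes "finite_measure N" "finite \<T>" "laminar \<T>" "\<T> \<subseteq> sets N"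
    and [measurable]: "g \<in> borel_measurable N" and "\<And>x. 0 \<le> g x" and "0 < t"
    and large: "\<And>S. S \<in> \<T> \<Longrightarrow> ennreal t * emeasure N S \<le> (\<integral>\<^sup>+x\<in>S. g x \<partial>N)"
  shows "emeasure N (\<Union>\<T>) \<le> ennreal (2 / t) * (\<integral>\<^sup>+x. ennreal (g x) * indicator {x. t \<le> 2 * g x} x \<partial>N)"
proof -
  interpret finite_measure N by fact
  obtain \<S> where \<S>: "\<S> \<subseteq> \<T>" "disjoint \<S>" "\<Union>\<S> = \<Union>\<T>"
    using laminar_disjoint_cover assms by metis
  let ?U = "\<Union>\<T>"
  have fin: "finite \<S>" using \<S>(1) assms(2) finite_subset by blast
  have sets: "S \<in> sets N" if "S \<in> \<S>" for S using that \<S> assms by auto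
  have U[measurable]: "?U \<in> sets N" using assms by auto
  have df: "disjoint_family_on (\<lambda>S. S) \<S>"
    using \<S>(2) by (auto simp: disjoint_def disjoint_family_on_def)
  have "ennreal t * emeasure N ?U = (\<Sum>S\<in>\<S>. ennreal t * emeasure N S)"
    using sum_emeasure[of "\<lambda>S. S" \<S> N] df fin sets \<S>(3)
    by (auto simp: sum_distrib_left[symmetric] subset_iff)
  also have "\<dots> \<le> (\<Sum>S\<in>\<S>. \<integral>\<^sup>+x\<in>S. g x \<partial>N)"
    using \<S> large by (intro sum_mono) auto
  also have "\<dots> = (\<integral>\<^sup>+x. (\<Sum>S\<in>\<S>. ennreal (g x) * indicator S x) \<partial>N)"
    using sets by (subst nn_integral_sum) auto
  also have "\<dots> = (\<integral>\<^sup>+x. ennreal (g x) * indicator ?U x \<partial>N)"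
  proof -
    have "(\<Sum>S\<in>\<S>. indicator S x) = (indicator ?U x :: ennreal)" for x
      unfolding \<S>(3)[symmetric] using fin df by (subst indicator_UN_disjoint[symmetric]) auto
    then show ?thesis by (simp add: sum_distrib_left[symmetric])
  qed
  also have "\<dots> \<le> (\<integral>\<^sup>+x. ennreal (g x) * indicator {x. t \<le> 2 * g x} x + ennreal (t / 2) * indicator ?U x \<partial>N)"
    using \<open>0 < t\<close> by (intro nn_integral_mono) (auto simp: indicator_def intro!: ennreal_leI)
  also have "\<dots> = (\<integral>\<^sup>+x. ennreal (g x) * indicator {x. t \<le> 2 * g x} x \<partial>N) + ennreal (t / 2) * emeasure N ?U"
    by (subst nn_integral_add) (auto simp: nn_integral_cmult)
  finally have *: "ennreal t * emeasure N ?U \<le>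
      (\<integral>\<^sup>+x. ennreal (g x) * indicator {x. t \<le> 2 * g x} x \<partial>N) + ennreal (t / 2) * emeasure N ?U" .
  show ?thesis
  proof (cases "\<integral>\<^sup>+x. ennreal (g x) * indicator {x. t \<le> 2 * g x} x \<partial>N")
    case (real r)
    have "t * measure N ?U \<le> r + t / 2 * measure N ?U"
      using * real \<open>0 < t\<close>
      by (simp add: emeasure_eq_measure ennreal_mult[symmetric] ennreal_plus[symmetric] del: ennreal_plus)
    then have "measure N ?U \<le> 2 / t * r"
      using \<open>0 < t\<close> by (simp add: field_simps)
    then show ?thesis
      using real \<open>0 < t\<close> by (simp add: emeasure_eq_measure ennreal_mult[symmetric] ennreal_leI)
  next
    case top
    then show ?thesis using \<open>0 < t\<close> by (simp add: ennreal_mult_top)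
  qed
qed

text \<open>
  Layer cake in \<open>a i\<close>: at height \<open>t\<close> the disjoint sets \<open>E i\<close> with \<open>t \<le> a i\<close> have at most the measure
  of the union of the corresponding \<open>T i\<close>, to which the weak type estimate applies. Integrating its
  right-hand side over \<open>t\<close> first gives the power of \<open>g\<close>.
\<close>

lemma carleson_embedding:
  fixes g :: "'a \<Rightarrow> real" and E T :: "'i \<Rightarrow> 'a set"
  assumes "finite_measure N" "finite I" "laminar (T ` I)" "disjoint_family_on E I"
    and sets: "\<And>i. i \<in> I \<Longrightarrow> T i \<in> sets N" "\<And>i. i \<in> I \<Longrightarrow> E i \<in> sets N"
    and sub: "\<And>i. i \<in> I \<Longrightarrow> E i \<subseteq> T i"
    and g[measurable]: "g \<in> borel_measurable N" and nonneg: "\<And>x. 0 \<le> g x"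
    and a: "\<And>i. i \<in> I \<Longrightarrow> 0 \<le> a i"
    and avg: "\<And>i. i \<in> I \<Longrightarrow> ennreal (a i) * emeasure N (T i) \<le> (\<integral>\<^sup>+x\<in>T i. g x \<partial>N)"
    and "1 < p"
  shows "(\<Sum>i\<in>I. emeasure N (E i) * ennreal (a i powr p))
    \<le> ennreal (p * 2 powr p / (p - 1)) * (\<integral>\<^sup>+x. ennreal (g x powr p) \<partial>N)"
proof -
  interpret finite_measure N by fact
  have sf: "sigma_finite_measure N" by unfold_locales
  interpret pair_sigma_finite lborel N
    by (intro pair_sigma_finite.intro sf lborel.sigma_finite_measure_axioms)
  define L where "L t = ennreal (p * t powr (p - 1))" for t :: real
  have [measurable]: "L \<in> borel_measurable borel" unfolding L_def by measurable
  have powr_as_integral: "ennreal (b powr p) = (\<integral>\<^sup>+t. L t * indicator {0..b} t \<partial>lborel)" if "0 \<le> b" for b :: real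
  proof -
    have "(\<integral>\<^sup>+t. L t * indicator {0..b} t \<partial>lborel)
        = ennreal p * (\<integral>\<^sup>+t. ennreal (t powr (p - 1)) * indicator {0..b} t \<partial>lborel)"
      using \<open>1 < p\<close> by (subst nn_integral_cmult[symmetric]) (auto simp: L_def ennreal_mult mult.assoc)
    also have "\<dots> = ennreal (b powr p)"
      using that \<open>1 < p\<close> by (subst nn_integral_powr_from_0) (auto simp: ennreal_mult[symmetric])
    finally show ?thesis by simp
  qed
  have "(\<Sum>i\<in>I. emeasure N (E i) * ennreal (a i powr p))
      = (\<Sum>i\<in>I. \<integral>\<^sup>+t. emeasure N (E i) * (L t * indicator {0..a i} t) \<partial>lborel)"
    using a by (intro sum.cong) (auto simp: powr_as_integral nn_integral_cmult)
  also have "\<dots> = (\<integral>\<^sup>+t. (\<Sum>i\<in>I. emeasure N (E i) * (L t * indicator {0..a i} t)) \<partial>lborel)"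
    by (subst nn_integral_sum) auto
  also have "\<dots> \<le> (\<integral>\<^sup>+t. (\<integral>\<^sup>+x. L t * ennreal (2 / t) * (ennreal (g x) * indicator {0..2 * g x} t) \<partial>N) \<partial>lborel)"
  proof (intro nn_integral_mono)
    fix t :: real
    show "(\<Sum>i\<in>I. emeasure N (E i) * (L t * indicator {0..a i} t))
      \<le> (\<integral>\<^sup>+x. L t * ennreal (2 / t) * (ennreal (g x) * indicator {0..2 * g x} t) \<partial>N)"
    proof (cases "0 < t")
      case False
      then have "t < 0 \<or> t = 0" by auto
      then show ?thesis by (auto simp: L_def)
    next
      case True
      define J where "J = {i \<in> I. t \<le> a i}"
      have J: "finite J" "J \<subseteq> I" using assms(2) by (auto simp: J_def)
      have "(\<Sum>i\<in>I. emeasure N (E i) * (L t * indicator {0..a i} t)) = (\<Sum>i\<in>J. L t * emeasure N (E i))"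
        unfolding J_def using True assms(2) by (intro sum.mono_neutral_cong_right) (auto simp: indicator_def mult.commute)
      also have "\<dots> = L t * emeasure N (\<Union>i\<in>J. E i)"
        using J sets(2) disjoint_family_on_mono[OF J(2) assms(4)]
        by (subst sum_emeasure[symmetric]) (auto simp: sum_distrib_left)
      also have "\<dots> \<le> L t * emeasure N (\<Union>(T ` J))"
        using J sets sub by (intro mult_left_mono emeasure_mono) (blast, auto)
      also have "\<dots> \<le> L t * (ennreal (2 / t) * (\<integral>\<^sup>+x. ennreal (g x) * indicator {x. t \<le> 2 * g x} x \<partial>N))"
      proof (intro mult_left_mono laminar_weak_type)
        show "laminar (T ` J)" using assms(3) J by (auto intro: laminar_subset)
        fix S assume "S \<in> T ` J"
        then obtain i where i: "i \<in> I" "S = T i" "t \<le> a i" by (auto simp: J_def)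
        have "ennreal t * emeasure N S \<le> ennreal (a i) * emeasure N S"
          using i by (intro mult_right_mono ennreal_leI) auto
        also have "\<dots> \<le> (\<integral>\<^sup>+x\<in>S. g x \<partial>N)" using avg i by auto
        finally show "ennreal t * emeasure N S \<le> (\<integral>\<^sup>+x\<in>S. g x \<partial>N)" .
      qed (use J sets True nonneg in \<open>auto simp: finite_measure_axioms\<close>)
      also have "\<dots> = (\<integral>\<^sup>+x. L t * ennreal (2 / t) * (ennreal (g x) * indicator {0..2 * g x} t) \<partial>N)"
        using True by (subst nn_integral_cmult[symmetric])
          (auto intro!: nn_integral_cong simp: indicator_def nn_integral_cmult[symmetric] mult.assoc)
      finally show ?thesis .
    qed
  qed
  also
  have [measurable]: "Measurable.pred (borel \<Otimes>\<^sub>M N) (\<lambda>x. fst x \<in> {0..2 * g (snd x)})"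
    unfolding atLeastAtMost_iff by measurable
  have "(\<integral>\<^sup>+t. (\<integral>\<^sup>+x. L t * ennreal (2 / t) * (ennreal (g x) * indicator {0..2 * g x} t) \<partial>N) \<partial>lborel)
      = (\<integral>\<^sup>+x. (\<integral>\<^sup>+t. L t * ennreal (2 / t) * (ennreal (g x) * indicator {0..2 * g x} t) \<partial>lborel) \<partial>N)"
    by (rule Fubini'[symmetric]) measurable
  also have "\<dots> = (\<integral>\<^sup>+x. ennreal (p * 2 powr p / (p - 1)) * ennreal (g x powr p) \<partial>N)"
  proof (rule nn_integral_cong)
    fix x
    have "(\<integral>\<^sup>+t. L t * ennreal (2 / t) * (ennreal (g x) * indicator {0..2 * g x} t) \<partial>lborel)
      = (\<integral>\<^sup>+t. ennreal (2 * p * g x) * (ennreal (t powr (p - 2)) * indicator {0..2 * g x} t) \<partial>lborel)"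
    proof (rule nn_integral_cong)
      fix t :: real
      have "p * t powr (p - 1) * (2 / t) * g x = 2 * p * g x * t powr (p - 2)" if "0 < t"
        using that by (simp add: powr_diff power2_eq_square)
      then show "L t * ennreal (2 / t) * (ennreal (g x) * indicator {0..2 * g x} t)
        = ennreal (2 * p * g x) * (ennreal (t powr (p - 2)) * indicator {0..2 * g x} t)"
        using nonneg[of x] \<open>1 < p\<close>
        by (cases "0 < t") (auto simp: L_def indicator_def ennreal_mult[symmetric])
    qed
    also have "\<dots> = ennreal (2 * p * g x) * ennreal ((2 * g x) powr (p - 1) / (p - 1))"
      using nonneg[of x] \<open>1 < p\<close> nn_integral_powr_from_0[of "p - 2" "2 * g x"] by (subst nn_integral_cmult) auto
    also have "\<dots> = ennreal (p * 2 powr p / (p - 1) * g x powr p)"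
    proof -
      have "2 * g x * (2 * g x) powr (p - 1) = 2 powr p * g x powr p"
      proof (cases "g x = 0")
        case False
        then have "2 * g x > 0" using nonneg[of x] by auto
        then have "2 * g x * (2 * g x) powr (p - 1) = (2 * g x) powr p"
          by (simp add: powr_diff)
        then show ?thesis using nonneg[of x] by (simp add: powr_mult)
      qed auto
      then have "2 * p * g x * ((2 * g x) powr (p - 1) / (p - 1)) = p * 2 powr p / (p - 1) * g x powr p"
        by (metis (no_types, opaque_lifting) mult.assoc mult.commute times_divide_eq_right)
      then show ?thesis
        using nonneg[of x] \<open>1 < p\<close> by (subst ennreal_mult[symmetric]) auto
    qed
    finally show "(\<integral>\<^sup>+t. L t * ennreal (2 / t) * (ennreal (g x) * indicator {0..2 * g x} t) \<partial>lborel)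
      = ennreal (p * 2 powr p / (p - 1)) * ennreal (g x powr p)"
      using nonneg[of x] \<open>1 < p\<close> by (subst ennreal_mult[symmetric]) auto
  qed
  also have "\<dots> = ennreal (p * 2 powr p / (p - 1)) * (\<integral>\<^sup>+x. ennreal (g x powr p) \<partial>N)"
    by (rule nn_integral_cmult) auto
  finally show ?thesis .
qed

lemma set_nn_integral_eq_set_integral:
  fixes h :: "'a \<Rightarrow> real"
  assumes "integrable M h" "\<And>x. 0 \<le> h x" "A \<in> sets M"
  shows "(\<integral>\<^sup>+x\<in>A. h x \<partial>M) = ennreal (LINT x:A|M. h x)"
proof -
  have "(\<integral>\<^sup>+x\<in>A. h x \<partial>M) = (\<integral>\<^sup>+x. ennreal (indicator A x *\<^sub>R h x) \<partial>M)"
    by (intro nn_integral_cong) (auto simp: indicator_def)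
  also have "\<dots> = ennreal (LINT x:A|M. h x)"
    unfolding set_lebesgue_integral_def
    using assms by (intro nn_integral_eq_integral integrable_mult_indicator) auto
  finally show ?thesis .
qed

lemma set_integral_nonneg_all:
  fixes h :: "'a \<Rightarrow> real"
  shows "(\<And>x. 0 \<le> h x) \<Longrightarrow> 0 \<le> (LINT x:A|M. h x)"
  unfolding set_lebesgue_integral_def by (intro integral_nonneg_AE) auto

lemma set_integral_mono_superset:
  fixes h :: "'a \<Rightarrow> real"
  assumes "integrable M h" "\<And>x. 0 \<le> h x" "A \<in> sets M" "B \<in> sets M" "A \<subseteq> B"
  shows "(LINT x:A|M. h x) \<le> (LINT x:B|M. h x)"
  unfolding set_lebesgue_integral_def
  using assms by (intro integral_mono integrable_mult_indicator mult_right_mono) (auto simp: indicator_def)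

lemma carleson_embedding_weighted:
  fixes g \<sigma> :: "'a \<Rightarrow> real" and E T :: "'i \<Rightarrow> 'a set"
  assumes "finite I" "laminar (T ` I)" "disjoint_family_on E I"
    and sets: "\<And>i. i \<in> I \<Longrightarrow> T i \<in> sets M" "\<And>i. i \<in> I \<Longrightarrow> E i \<in> sets M"
    and sub: "\<And>i. i \<in> I \<Longrightarrow> E i \<subseteq> T i"
    and [measurable]: "g \<in> borel_measurable M" and nonneg: "\<And>x. 0 \<le> g x"
    and \<sigma>: "integrable M \<sigma>" "\<And>x. 0 \<le> \<sigma> x"
    and int: "integrable M (\<lambda>x. g x * \<sigma> x)" "integrable M (\<lambda>x. g x powr p * \<sigma> x)"
    and "1 < p"
  shows "(\<Sum>i\<in>I. (LINT x:E i|M. \<sigma> x) * ((LINT x:T i|M. g x * \<sigma> x) / (LINT x:T i|M. \<sigma> x)) powr p)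
    \<le> p * 2 powr p / (p - 1) * (LINT x|M. g x powr p * \<sigma> x)"
proof -
  define N where "N = density M (\<lambda>x. ennreal (\<sigma> x))"
  define a where "a i = (LINT x:T i|M. g x * \<sigma> x) / (LINT x:T i|M. \<sigma> x)" for i
  have [measurable]: "\<sigma> \<in> borel_measurable M" using \<sigma> by auto
  have sets_N: "sets N = sets M" and N_meas: "borel_measurable N = borel_measurable M"
    by (auto simp: N_def)
  have emeasure_N: "emeasure N A = ennreal (LINT x:A|M. \<sigma> x)" if "A \<in> sets M" for A
    using that \<sigma> by (simp add: N_def emeasure_density set_nn_integral_eq_set_integral)
  have nn_integral_N: "(\<integral>\<^sup>+x\<in>A. h x \<partial>N) = ennreal (LINT x:A|M. h x * \<sigma> x)"
    if "A \<in> sets M" "integrable M (\<lambda>x. h x * \<sigma> x)" "\<And>x. 0 \<le> h x"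
      and [measurable]: "h \<in> borel_measurable M" for A and h :: "'a \<Rightarrow> real"
  proof -
    have [measurable]: "A \<in> sets M" by fact
    have "(\<integral>\<^sup>+x\<in>A. h x \<partial>N) = (\<integral>\<^sup>+x\<in>A. h x * \<sigma> x \<partial>M)"
      unfolding N_def using that \<sigma>
      by (subst nn_integral_density) (auto intro!: nn_integral_cong simp: ennreal_mult mult_ac)
    then show ?thesis
      using that \<sigma> by (simp add: set_nn_integral_eq_set_integral)
  qed
  have fin: "finite_measure N"
  proof
    show "emeasure N (space N) \<noteq> \<infinity>"
      using emeasure_N[of "space M"] by (simp add: N_def)
  qed
  have a_nonneg: "0 \<le> a i" for i
    unfolding a_def using nonneg \<sigma> by (intro divide_nonneg_nonneg set_integral_nonneg_all) auto
  have "(\<Sum>i\<in>I. emeasure N (E i) * ennreal (a i powr p))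
    \<le> ennreal (p * 2 powr p / (p - 1)) * (\<integral>\<^sup>+x. ennreal (g x powr p) \<partial>N)"
  proof (rule carleson_embedding[OF fin assms(1-3)])
    fix i assume i: "i \<in> I"
    have S: "0 \<le> (LINT x:T i|M. \<sigma> x)" "0 \<le> (LINT x:T i|M. g x * \<sigma> x)"
      using nonneg \<sigma> by (auto intro!: set_integral_nonneg_all)
    have "a i * (LINT x:T i|M. \<sigma> x) \<le> (LINT x:T i|M. g x * \<sigma> x)"
      using S unfolding a_def by (cases "(LINT x:T i|M. \<sigma> x) = 0") auto
    then show "ennreal (a i) * emeasure N (T i) \<le> (\<integral>\<^sup>+x\<in>T i. g x \<partial>N)"
      using i sets S nonneg int a_nonneg
      by (simp add: emeasure_N nn_integral_N ennreal_mult[symmetric] ennreal_leI)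
  qed (use sets sub nonneg a_nonneg \<open>1 < p\<close> in \<open>auto simp: sets_N N_meas\<close>)
  moreover have "(\<integral>\<^sup>+x. ennreal (g x powr p) \<partial>N) = ennreal (LINT x|M. g x powr p * \<sigma> x)"
  proof -
    have "(\<integral>\<^sup>+x. ennreal (g x powr p) \<partial>N) = (\<integral>\<^sup>+x. ennreal (g x powr p * \<sigma> x) \<partial>M)"
      unfolding N_def using \<sigma>
      by (subst nn_integral_density) (auto intro!: nn_integral_cong simp: ennreal_mult mult_ac)
    also have "\<dots> = ennreal (LINT x|M. g x powr p * \<sigma> x)"
      using int \<sigma> by (intro nn_integral_eq_integral) auto
    finally show ?thesis .
  qed
  moreover have "(\<Sum>i\<in>I. emeasure N (E i) * ennreal (a i powr p))
      = ennreal (\<Sum>i\<in>I. (LINT x:E i|M. \<sigma> x) * a i powr p)"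
    using sets \<sigma> by (subst sum_ennreal[symmetric])
      (auto simp: emeasure_N ennreal_mult set_integral_nonneg_all)
  moreover have "0 \<le> (LINT x|M. g x powr p * \<sigma> x)"
    using \<sigma> by (intro integral_nonneg_AE) auto
  ultimately show ?thesis
    using \<open>1 < p\<close> unfolding a_def by (simp add: ennreal_mult[symmetric])
qed


section \<open>Positive dyadic operators on weighted spaces\<close>

text \<open>Hoelder's inequality for the factorization \<open>1 = \<sigma>^(1/p) * \<tau>^(1/q)\<close>.\<close>

lemma measure_le_dual_weights:
  fixes \<sigma> \<tau> :: "'a \<Rightarrow> real"
  assumes pq: "1 < p" "1 < q" "1 / p + 1 / q = 1"
    and \<sigma>: "integrable M \<sigma>" "\<And>x. 0 \<le> \<sigma> x" and \<tau>: "integrable M \<tau>" "\<And>x. 0 \<le> \<tau> x"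
    and dual: "\<And>x. \<sigma> x powr (1 / p) * \<tau> x powr (1 / q) = 1"
    and [measurable]: "A \<in> sets M"
  shows "measure M A \<le> (LINT x:A|M. \<sigma> x) powr (1 / p) * (LINT x:A|M. \<tau> x) powr (1 / q)"
proof -
  have [measurable]: "\<sigma> \<in> borel_measurable M" "\<tau> \<in> borel_measurable M" using \<sigma> \<tau> by auto
  have *: "(indicator A x * \<sigma> x powr (1 / p)) powr p = indicator A x *\<^sub>R \<sigma> x"
      "(indicator A x * \<tau> x powr (1 / q)) powr q = indicator A x *\<^sub>R \<tau> x" for x
    using pq \<sigma> \<tau> by (auto simp: indicator_def powr_powr)
  have "(LINT x|M. (indicator A x * \<sigma> x powr (1 / p)) * (indicator A x * \<tau> x powr (1 / q)))
    \<le> (LINT x|M. (indicator A x * \<sigma> x powr (1 / p)) powr p) powr (1 / p)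
      * (LINT x|M. (indicator A x * \<tau> x powr (1 / q)) powr q) powr (1 / q)"
    using \<sigma> \<tau> by (intro Holder_integral(2)[OF pq]) (auto simp: * simp del: real_scaleR_def intro!: integrable_mult_indicator)
  also have "(LINT x|M. (indicator A x * \<sigma> x powr (1 / p)) * (indicator A x * \<tau> x powr (1 / q)))
      = (LINT x|M. indicator A x)"
    using dual by (intro Bochner_Integration.integral_cong) (auto simp: indicator_def)
  finally show ?thesis
    by (simp add: * set_lebesgue_integral_def)
qed

text \<open>
  The hypothesis on \<open>c\<close> extracts the characteristic \<open>B\<close> from each term. What is left of the volume and
  of the weights of \<open>T i\<close> is \<open>m i powr (p - 1) * t i powr (2 - p)\<close>, and because \<open>2 - p \<le> 0\<close> it can be
  estimated by weights of the disjoint sets \<open>E i\<close>, as the embedding theorem requires. Here \<open>m i\<close> is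
  the measure of \<open>T i\<close> and \<open>t i\<close> the integral of \<open>\<tau>\<close> over it.
\<close>

lemma sparse_form_bound_ge_2:
  fixes f g \<sigma> \<tau> :: "'a \<Rightarrow> real" and E T :: "'i \<Rightarrow> 'a set" and c :: "'i \<Rightarrow> real"
  assumes pq: "2 \<le> p" "1 < q" "1 / p + 1 / q = 1"
    and I: "finite I" "laminar (T ` I)" "disjoint_family_on E I"
    and sets: "\<And>i. i \<in> I \<Longrightarrow> T i \<in> sets M" "\<And>i. i \<in> I \<Longrightarrow> E i \<in> sets M"
    and sub: "\<And>i. i \<in> I \<Longrightarrow> E i \<subseteq> T i"
    and sparse: "\<And>i. i \<in> I \<Longrightarrow> 0 < measure M (T i)" "\<And>i. i \<in> I \<Longrightarrow> measure M (T i) \<le> A * measure M (E i)"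
    and \<sigma>: "integrable M \<sigma>" "\<And>x. 0 \<le> \<sigma> x" and \<tau>: "integrable M \<tau>" "\<And>x. 0 \<le> \<tau> x"
    and dual: "\<And>x. \<sigma> x powr (1 / p) * \<tau> x powr (1 / q) = 1"
    and c: "\<And>i. i \<in> I \<Longrightarrow> 0 \<le> c i" and "0 < A"
    and B: "\<And>i. i \<in> I \<Longrightarrow> c i * ((LINT x:T i|M. \<sigma> x) / measure M (T i))
          * ((LINT x:T i|M. \<tau> x) / measure M (T i)) powr (p - 1) \<le> B" "0 \<le> B"
    and f[measurable]: "f \<in> borel_measurable M" and f_nonneg: "\<And>x. 0 \<le> f x"
    and f_int: "integrable M (\<lambda>x. f x * \<tau> x)" "integrable M (\<lambda>x. f x powr p * \<tau> x)"
    and g[measurable]: "g \<in> borel_measurable M" and g_nonneg: "\<And>x. 0 \<le> g x"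
    and g_int: "integrable M (\<lambda>x. g x * \<sigma> x)" "integrable M (\<lambda>x. g x powr q * \<sigma> x)"
  shows "(\<Sum>i\<in>I. c i * (LINT x:T i|M. f x * \<tau> x) * (LINT x:T i|M. g x * \<sigma> x) / measure M (T i))
    \<le> A powr (p - 1) * (p * 2 powr p / (p - 1)) powr (1 / p) * (q * 2 powr q / (q - 1)) powr (1 / q) * B
      * (LINT x|M. f x powr p * \<tau> x) powr (1 / p) * (LINT x|M. g x powr q * \<sigma> x) powr (1 / q)"
proof -
  have p1: "1 < p" using pq by simp
  define F where "F i = (LINT x:T i|M. f x * \<tau> x) / (LINT x:T i|M. \<tau> x)" for i
  define G where "G i = (LINT x:T i|M. g x * \<sigma> x) / (LINT x:T i|M. \<sigma> x)" for i
  define t where "t i = (LINT x:T i|M. \<tau> x)" for i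
  define s where "s i = (LINT x:T i|M. \<sigma> x)" for i
  define tE where "tE i = (LINT x:E i|M. \<tau> x)" for i
  define sE where "sE i = (LINT x:E i|M. \<sigma> x)" for i
  define m where "m i = measure M (T i)" for i
  define e where "e i = measure M (E i)" for i
  have nonneg: "0 \<le> F i" "0 \<le> G i" "0 \<le> t i" "0 \<le> s i" "0 \<le> tE i" "0 \<le> sE i" "0 \<le> e i" for i
    unfolding F_def G_def t_def s_def tE_def sE_def e_def using f_nonneg g_nonneg \<sigma> \<tau>
    by (auto intro!: divide_nonneg_nonneg set_integral_nonneg_all)
  have term_bound: "c i * (LINT x:T i|M. f x * \<tau> x) * (LINT x:T i|M. g x * \<sigma> x) / m i
      \<le> A powr (p - 1) * B * ((tE i powr (1 / p) * F i) * (sE i powr (1 / q) * G i))" if i: "i \<in> I" for i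
  proof -
    have e: "0 < e i"
      using sparse[OF i] \<open>0 < A\<close> unfolding e_def by (smt (verit) zero_less_mult_iff)
    have m: "0 < m i" "m i \<le> A * e i" using sparse i by (auto simp: m_def e_def)
    have e_le: "e i \<le> sE i powr (1 / p) * tE i powr (1 / q)"
      unfolding e_def sE_def tE_def by (rule measure_le_dual_weights[OF p1 pq(2,3) \<sigma> \<tau> dual sets(2)[OF i]])
    then have E_pos: "0 < sE i" "0 < tE i"
      using e nonneg[of i] by (auto simp: order.strict_iff_order)
    have mono: "tE i \<le> t i" "sE i \<le> s i"
      unfolding tE_def t_def sE_def s_def using sub[OF i] sets i \<sigma> \<tau>
      by (auto intro!: set_integral_mono_superset)
    have pos: "0 < t i" "0 < s i" using E_pos mono by auto
    have Ft: "(LINT x:T i|M. f x * \<tau> x) = F i * t i" and Gs: "(LINT x:T i|M. g x * \<sigma> x) = G i * s i"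
      using pos by (auto simp: F_def G_def t_def s_def)
    have size: "m i powr (p - 1) * t i powr (2 - p) \<le> A powr (p - 1) * (sE i powr (1 / q) * tE i powr (1 / p))"
    proof -
      have exps: "(1 / p) * (p - 1) = 1 / q" "(1 / q) * (p - 1) + (2 - p) = 1 / p"
        using pq p1 by (auto simp: field_simps)
      have "m i powr (p - 1) * t i powr (2 - p) \<le> (A * e i) powr (p - 1) * tE i powr (2 - p)"
        using m mono E_pos pq by (intro mult_mono powr_mono2 powr_mono2') auto
      also have "\<dots> \<le> (A * (sE i powr (1 / p) * tE i powr (1 / q))) powr (p - 1) * tE i powr (2 - p)"
        using e_le e \<open>0 < A\<close> pq by (intro mult_right_mono powr_mono2) auto
      also have "\<dots> = A powr (p - 1) * (sE i powr ((1 / p) * (p - 1)) * (tE i powr ((1 / q) * (p - 1)) * tE i powr (2 - p)))"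
        using \<open>0 < A\<close> E_pos by (simp add: powr_mult powr_powr)
      also have "\<dots> = A powr (p - 1) * (sE i powr (1 / q) * tE i powr (1 / p))"
        unfolding powr_add[symmetric] exps ..
      finally show ?thesis .
    qed
    have "c i * (F i * t i) * (G i * s i) / m i
        = (c i * (s i / m i) * (t i / m i) powr (p - 1)) * (m i powr (p - 1) * t i powr (2 - p)) * (F i * G i)"
    proof -
      have "t i powr (p - 1) * t i powr (2 - p) = t i"
        using pos by (simp add: powr_add[symmetric])
      then have "(t i / m i) powr (p - 1) * (m i powr (p - 1) * t i powr (2 - p)) = t i"
        using m pos by (simp add: powr_divide)
      then show ?thesis by (simp add: mult_ac)
    qed
    also have "\<dots> \<le> B * (A powr (p - 1) * (sE i powr (1 / q) * tE i powr (1 / p))) * (F i * G i)"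
    proof -
      have "c i * (s i / m i) * (t i / m i) powr (p - 1) \<le> B"
        using B(1)[OF i] by (simp add: s_def t_def m_def)
      then show ?thesis
        using B(2) nonneg[of i] by (intro mult_right_mono mult_mono size) auto
    qed
    finally show ?thesis unfolding Ft Gs by (simp add: mult_ac)
  qed
  have "(\<Sum>i\<in>I. c i * (LINT x:T i|M. f x * \<tau> x) * (LINT x:T i|M. g x * \<sigma> x) / measure M (T i))
      \<le> A powr (p - 1) * B * (\<Sum>i\<in>I. (tE i powr (1 / p) * F i) * (sE i powr (1 / q) * G i))"
    unfolding sum_distrib_left using term_bound by (intro sum_mono) (auto simp: m_def)
  also have "\<dots> \<le> A powr (p - 1) * B * ((\<Sum>i\<in>I. (tE i powr (1 / p) * F i) powr p) powr (1 / p)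
        * (\<Sum>i\<in>I. (sE i powr (1 / q) * G i) powr q) powr (1 / q))"
    using nonneg B(2) by (intro mult_left_mono Holder_sum[OF p1 pq(2,3) I(1)]) auto
  also have "\<dots> = A powr (p - 1) * B * ((\<Sum>i\<in>I. tE i * F i powr p) powr (1 / p)
        * (\<Sum>i\<in>I. sE i * G i powr q) powr (1 / q))"
    using nonneg pq p1 by (simp add: powr_mult powr_powr)
  also have "\<dots> \<le> A powr (p - 1) * B * ((p * 2 powr p / (p - 1) * (LINT x|M. f x powr p * \<tau> x)) powr (1 / p)
        * (q * 2 powr q / (q - 1) * (LINT x|M. g x powr q * \<sigma> x)) powr (1 / q))"
    unfolding tE_def sE_def F_def G_def
    using B(2) p1 pq \<sigma> \<tau>
    by (intro mult_left_mono mult_mono powr_mono2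
        carleson_embedding_weighted[OF I sets sub f f_nonneg \<tau> f_int p1]
        carleson_embedding_weighted[OF I sets sub g g_nonneg \<sigma> g_int pq(2)])
      (auto intro!: sum_nonneg mult_nonneg_nonneg set_integral_nonneg_all)
  also have "\<dots> = A powr (p - 1) * (p * 2 powr p / (p - 1)) powr (1 / p) * (q * 2 powr q / (q - 1)) powr (1 / q) * B
      * (LINT x|M. f x powr p * \<tau> x) powr (1 / p) * (LINT x|M. g x powr q * \<sigma> x) powr (1 / q)"
  proof -
    have "0 \<le> (LINT x|M. f x powr p * \<tau> x)" "0 \<le> (LINT x|M. g x powr q * \<sigma> x)"
      using \<sigma> \<tau> by (auto intro!: integral_nonneg_AE)
    then show ?thesis
      using p1 pq by (subst (1 2) powr_mult) (auto simp: mult_ac)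
  qed
  finally show ?thesis .
qed

text \<open>
  The last two factors come from the embedding theorem in \<open>L\<^sup>p\<close> and in \<open>L\<^sup>q\<close>; the power of the
  comparability constant \<open>A\<close> is \<open>p - 1\<close> if \<open>p \<ge> 2\<close> and \<open>q - 1\<close> otherwise.
\<close>

definition sparse_const :: "real \<Rightarrow> real \<Rightarrow> real \<Rightarrow> real" where
  "sparse_const A p q =
     A powr (max p q - 1) * (p * 2 powr p / (p - 1)) powr (1 / p) * (q * 2 powr q / (q - 1)) powr (1 / q)"

text \<open>
  For \<open>p < 2\<close> the previous estimate is applied to the conjugate exponent with the two weights
  exchanged; raising the hypothesis to the power \<open>q - 1\<close> puts it into the required form.
\<close>

lemma sparse_form_bound:
  fixes f g \<sigma> \<tau> :: "'a \<Rightarrow> real" and E T :: "'i \<Rightarrow> 'a set" and c :: "'i \<Rightarrow> real"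
  assumes pq: "1 < p" "1 < q" "1 / p + 1 / q = 1"
    and I: "finite I" "laminar (T ` I)" "disjoint_family_on E I"
    and sets: "\<And>i. i \<in> I \<Longrightarrow> T i \<in> sets M" "\<And>i. i \<in> I \<Longrightarrow> E i \<in> sets M"
    and sub: "\<And>i. i \<in> I \<Longrightarrow> E i \<subseteq> T i"
    and sparse: "\<And>i. i \<in> I \<Longrightarrow> 0 < measure M (T i)" "\<And>i. i \<in> I \<Longrightarrow> measure M (T i) \<le> A * measure M (E i)"
    and \<sigma>: "integrable M \<sigma>" "\<And>x. 0 \<le> \<sigma> x" and \<tau>: "integrable M \<tau>" "\<And>x. 0 \<le> \<tau> x"
    and dual: "\<And>x. \<sigma> x powr (1 / p) * \<tau> x powr (1 / q) = 1"
    and c: "\<And>i. i \<in> I \<Longrightarrow> 0 \<le> c i" and A: "0 < A"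
    and B: "\<And>i. i \<in> I \<Longrightarrow> c i powr min 1 (p - 1) * ((LINT x:T i|M. \<sigma> x) / measure M (T i))
          * ((LINT x:T i|M. \<tau> x) / measure M (T i)) powr (p - 1) \<le> B" "0 \<le> B"
    and f: "f \<in> borel_measurable M" "\<And>x. 0 \<le> f x"
      "integrable M (\<lambda>x. f x * \<tau> x)" "integrable M (\<lambda>x. f x powr p * \<tau> x)"
    and g: "g \<in> borel_measurable M" "\<And>x. 0 \<le> g x"
      "integrable M (\<lambda>x. g x * \<sigma> x)" "integrable M (\<lambda>x. g x powr q * \<sigma> x)"
  shows "(\<Sum>i\<in>I. c i * (LINT x:T i|M. f x * \<tau> x) * (LINT x:T i|M. g x * \<sigma> x) / measure M (T i))
    \<le> sparse_const A p q * B powr max 1 (1 / (p - 1))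
      * (LINT x|M. f x powr p * \<tau> x) powr (1 / p) * (LINT x|M. g x powr q * \<sigma> x) powr (1 / q)"
proof (cases "2 \<le> p")
  case True
  have "q \<le> 2"
  proof -
    have "1 / p \<le> 1 / 2" using pq True by (intro divide_left_mono) auto
    then have "1 / 2 \<le> 1 / q" using pq by linarith
    then show ?thesis using pq by (simp add: field_simps)
  qed
  then have "q \<le> p" using True by simp
  then have max: "max p q = p" by simp
  have "c i * ((LINT x:T i|M. \<sigma> x) / measure M (T i)) * ((LINT x:T i|M. \<tau> x) / measure M (T i)) powr (p - 1) \<le> B"
    if "i \<in> I" for i
    using B(1)[OF that] True c[OF that] by (simp add: min_def)
  from sparse_form_bound_ge_2[OF True pq(2,3) I sets sub sparse \<sigma> \<tau> dual c A this B(2) f g]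
  moreover have "max 1 (1 / (p - 1)) = 1" using True by simp
  ultimately show ?thesis
    using B(2) by (simp only: sparse_const_def max powr_one)
next
  case False
  have "2 \<le> q"
  proof -
    have "1 / 2 < 1 / p" using pq False by (intro divide_strict_left_mono) auto
    then have "1 / q < 1 / 2" using pq by linarith
    then show ?thesis using pq by (simp add: field_simps)
  qed
  then have max: "max p q = q" using False by simp
  have inv: "1 / (p - 1) = q - 1" using pq by (simp add: field_simps)
  have max': "max 1 (1 / (p - 1)) = q - 1" unfolding inv using \<open>2 \<le> q\<close> by simp
  have inv': "(p - 1) * (q - 1) = 1" using inv pq by (simp add: field_simps)
  have powr_swap: "(x powr (p - 1) * s * t powr (p - 1)) powr (q - 1) = x * t * s powr (q - 1)"
    if "0 \<le> x" "0 \<le> s" "0 \<le> t" for x s t :: real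
    using that inv' by (simp add: powr_mult powr_powr)
  have Bq: "c i * ((LINT x:T i|M. \<tau> x) / measure M (T i)) * ((LINT x:T i|M. \<sigma> x) / measure M (T i)) powr (q - 1) \<le> B powr (q - 1)"
    if i: "i \<in> I" for i
  proof -
    let ?s = "(LINT x:T i|M. \<sigma> x) / measure M (T i)" and ?t = "(LINT x:T i|M. \<tau> x) / measure M (T i)"
    have nonneg: "0 \<le> ?s" "0 \<le> ?t" "0 \<le> c i"
      using \<sigma> \<tau> c i by (auto intro!: divide_nonneg_nonneg set_integral_nonneg_all)
    have "0 \<le> c i powr (p - 1) * ?s * ?t powr (p - 1)"
      by (intro mult_nonneg_nonneg nonneg powr_ge_zero)
    moreover have "c i powr (p - 1) * ?s * ?t powr (p - 1) \<le> B"
      using B(1)[OF i] False by (simp add: min_def)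
    ultimately have "(c i powr (p - 1) * ?s * ?t powr (p - 1)) powr (q - 1) \<le> B powr (q - 1)"
      using pq by (intro powr_mono2) auto
    also have "(c i powr (p - 1) * ?s * ?t powr (p - 1)) powr (q - 1) = c i * ?t * ?s powr (q - 1)"
      by (rule powr_swap) (use nonneg in auto)
    finally show ?thesis .
  qed
  have pq': "1 / q + 1 / p = 1" "\<tau> x powr (1 / q) * \<sigma> x powr (1 / p) = 1" for x
    using pq dual by (auto simp: mult.commute add.commute)
  have "0 \<le> B powr (q - 1)" by simp
  from sparse_form_bound_ge_2[OF \<open>2 \<le> q\<close> pq(1) pq'(1) I sets sub sparse \<tau> \<sigma> pq'(2) c A Bq this g f]
  show ?thesis
    unfolding max' by (simp add: sparse_const_def max mult_ac)
qed

lemma integrable_of_weighted_Lp: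
  fixes h \<sigma> \<tau> :: "'a \<Rightarrow> real"
  assumes pq: "1 < p" "1 < q" "1 / p + 1 / q = 1"
    and \<sigma>: "\<sigma> \<in> borel_measurable M" "\<And>x. 0 \<le> \<sigma> x" and \<tau>: "integrable M \<tau>" "\<And>x. 0 \<le> \<tau> x"
    and dual: "\<And>x. \<sigma> x powr (1 / p) * \<tau> x powr (1 / q) = 1"
    and h: "h \<in> borel_measurable M" "\<And>x. 0 \<le> h x" "integrable M (\<lambda>x. h x powr p * \<sigma> x)"
  shows "integrable M h"
proof -
  have [measurable]: "\<sigma> \<in> borel_measurable M" "\<tau> \<in> borel_measurable M" "h \<in> borel_measurable M"
    using \<sigma> \<tau> h by auto
  have "integrable M (\<lambda>x. (h x * \<sigma> x powr (1 / p)) * \<tau> x powr (1 / q))"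
    using \<sigma> \<tau> h pq by (intro Holder_integral(1)[OF pq]) (auto simp: powr_mult powr_powr)
  then show ?thesis
    using dual by (simp add: mult.assoc)
qed

text \<open>
  The form is tested on \<open>g = S^(p - 1)\<close>, for which it equals \<open>\<integral>S^p \<sigma>\<close>; this integral is finite because
  \<open>S\<close> is a finite sum, so a power of it can be cancelled. The colours \<open>col\<close> separate several laminar
  families whose union need not be laminar, such as the tents of different dyadic structures.
\<close>

lemma sparse_operator_bound:
  fixes h \<sigma> \<tau> :: "'a \<Rightarrow> real" and E T :: "'i \<Rightarrow> 'a set" and c :: "'i \<Rightarrow> real" and col :: "'i \<Rightarrow> 'l"
  assumes pq: "1 < p" "1 < q" "1 / p + 1 / q = 1"
    and I: "finite I" "finite L" "\<And>i. i \<in> I \<Longrightarrow> col i \<in> L"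
    and col: "\<And>l. l \<in> L \<Longrightarrow> laminar (T ` {i \<in> I. col i = l})"
       "\<And>l. l \<in> L \<Longrightarrow> disjoint_family_on E {i \<in> I. col i = l}"
    and sets: "\<And>i. i \<in> I \<Longrightarrow> T i \<in> sets M" "\<And>i. i \<in> I \<Longrightarrow> E i \<in> sets M"
    and sub: "\<And>i. i \<in> I \<Longrightarrow> E i \<subseteq> T i"
    and sparse: "\<And>i. i \<in> I \<Longrightarrow> 0 < measure M (T i)" "\<And>i. i \<in> I \<Longrightarrow> measure M (T i) \<le> A * measure M (E i)"
    and \<sigma>: "integrable M \<sigma>" "\<And>x. 0 < \<sigma> x" and \<tau>: "integrable M \<tau>" "\<And>x. \<tau> x = \<sigma> x powr (1 - q)"
    and c: "\<And>i. i \<in> I \<Longrightarrow> 0 \<le> c i" and A: "0 < A"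
    and B: "\<And>i. i \<in> I \<Longrightarrow> c i powr min 1 (p - 1) * ((LINT x:T i|M. \<sigma> x) / measure M (T i))
          * ((LINT x:T i|M. \<tau> x) / measure M (T i)) powr (p - 1) \<le> B" "0 \<le> B"
    and h: "h \<in> borel_measurable M" "\<And>x. 0 \<le> h x" "integrable M (\<lambda>x. h x powr p * \<sigma> x)"
  defines "S \<equiv> \<lambda>z. \<Sum>i\<in>I. c i / measure M (T i) * (LINT x:T i|M. h x) * indicator (T i) z"
  shows "integrable M (\<lambda>x. S x powr p * \<sigma> x)"
    and "(LINT x|M. S x powr p * \<sigma> x) powr (1 / p) \<le>
       real (card L) * sparse_const A p q * B powr max 1 (1 / (p - 1)) * (LINT x|M. h x powr p * \<sigma> x) powr (1 / p)"
proof -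
  have [measurable]: "\<sigma> \<in> borel_measurable M" "\<tau> \<in> borel_measurable M" "h \<in> borel_measurable M"
    using \<sigma> \<tau> h by auto
  have \<sigma>': "0 \<le> \<sigma> x" for x using \<sigma>(2)[of x] by simp
  have \<tau>': "0 < \<tau> x" "0 \<le> \<tau> x" for x using \<sigma>(2)[of x] by (auto simp: \<tau>(2))
  have exps: "1 / p + (1 - q) * (1 / q) = 0" "(1 - q) * (1 - p) = 1" "(p - 1) * q = p"
    using pq by (auto simp: field_simps)
  have dual: "\<sigma> x powr (1 / p) * \<tau> x powr (1 / q) = 1" for x
    using \<sigma>(2)[of x] exps(1) by (simp add: \<tau> powr_powr powr_add[symmetric])
  have h_int: "integrable M h"
    by (rule integrable_of_weighted_Lp[OF pq _ \<sigma>' \<tau>(1) \<tau>'(2) dual h]) auto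
  \<comment> \<open>\<open>f\<close> is \<open>h\<close> as a density with respect to \<open>\<tau>\<close>; its norm in \<open>L\<^sup>p(\<tau>)\<close> is that of \<open>h\<close> in \<open>L\<^sup>p(\<sigma>)\<close>\<close>
  define f where "f x = h x / \<tau> x" for x
  have f_\<tau>: "f x * \<tau> x = h x" and fp_\<tau>: "f x powr p * \<tau> x = h x powr p * \<sigma> x" for x
  proof -
    show "f x * \<tau> x = h x" using \<tau>'(1)[of x] by (simp add: f_def)
    have "\<tau> x powr (1 - p) = \<sigma> x" using \<sigma>(2)[of x] exps(2) by (simp add: \<tau> powr_powr)
    then have "\<tau> x / \<tau> x powr p = \<sigma> x" using \<tau>'(1)[of x] by (simp add: powr_diff)
    then show "f x powr p * \<tau> x = h x powr p * \<sigma> x"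
      using h(2)[of x] \<tau>'(1)[of x] by (simp add: f_def powr_divide) (metis times_divide_eq_right)
  qed
  define coef where "coef i = c i / measure M (T i) * (LINT x:T i|M. h x)" for i
  have coef: "0 \<le> coef i" if "i \<in> I" for i
    unfolding coef_def using c[OF that] h(2) by (intro mult_nonneg_nonneg divide_nonneg_nonneg set_integral_nonneg_all) auto
  have S_eq: "S z = (\<Sum>i\<in>I. coef i * indicator (T i) z)" for z
    by (simp add: S_def coef_def)
  have S_meas[measurable]: "S \<in> borel_measurable M"
    unfolding S_eq[abs_def] using sets by (intro borel_measurable_sum borel_measurable_times borel_measurable_indicator) auto
  have S_nonneg: "0 \<le> S z" and S_le: "S z \<le> sum coef I" for z
    unfolding S_eq using coef by (auto intro!: sum_nonneg sum_mono simp: indicator_def)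
  have bdd: "integrable M (\<lambda>x. S x powr r * \<sigma> x)" if "0 < r" for r
  proof (rule Bochner_Integration.integrable_bound)
    show "integrable M (\<lambda>x. (sum coef I) powr r * \<sigma> x)" using \<sigma> by auto
    show "AE x in M. norm (S x powr r * \<sigma> x) \<le> norm ((sum coef I) powr r * \<sigma> x)"
      using S_nonneg S_le \<sigma>' that by (intro AE_I2) (auto simp: abs_mult intro!: mult_right_mono powr_mono2)
  qed auto
  from bdd[of p] show int_Sp: "integrable M (\<lambda>x. S x powr p * \<sigma> x)" using pq by simp
  define g where "g x = S x powr (p - 1)" for x
  have gq: "g x powr q = S x powr p" for x
    using S_nonneg exps(3) by (simp add: g_def powr_powr)
  have g_int: "integrable M (\<lambda>x. g x * \<sigma> x)" unfolding g_def using bdd[of "p - 1"] pq by simp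
  define X where "X = (LINT x|M. S x powr p * \<sigma> x)"
  define Y where "Y = (LINT x|M. h x powr p * \<sigma> x)"
  have X_nonneg: "0 \<le> X" unfolding X_def using \<sigma>' by (intro integral_nonneg_AE) auto
  let ?K = "sparse_const A p q * B powr max 1 (1 / (p - 1)) * Y powr (1 / p)"
  have part: "(\<Sum>i\<in>{i \<in> I. col i = l}. coef i * (LINT x:T i|M. g x * \<sigma> x)) \<le> ?K * X powr (1 / q)" if l: "l \<in> L" for l
  proof -
    have [measurable]: "f \<in> borel_measurable M" "g \<in> borel_measurable M"
      unfolding f_def g_def by measurable
    have "(\<Sum>i\<in>{i \<in> I. col i = l}. c i * (LINT x:T i|M. f x * \<tau> x) * (LINT x:T i|M. g x * \<sigma> x) / measure M (T i))
      \<le> sparse_const A p q * B powr max 1 (1 / (p - 1))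
        * (LINT x|M. f x powr p * \<tau> x) powr (1 / p) * (LINT x|M. g x powr q * \<sigma> x) powr (1 / q)"
    proof (rule sparse_form_bound[OF pq _ col[OF l] _ _ _ _ _ \<sigma>(1) \<sigma>' \<tau>(1) \<tau>'(2) dual _ A _ B(2)])
      show "0 \<le> f x" for x using h(2)[of x] \<tau>'(1)[of x] by (simp add: f_def)
    qed (use I sets sub sparse c B(1) int_Sp g_int h(3) h_int in \<open>simp_all add: gq f_\<tau> fp_\<tau>\<close>, simp add: g_def)
    then show ?thesis by (simp add: f_\<tau> fp_\<tau> gq X_def Y_def coef_def)
  qed
  have "X = (LINT x|M. (\<Sum>i\<in>I. coef i * (indicator (T i) x * (g x * \<sigma> x))))"
    unfolding X_def
  proof (rule Bochner_Integration.integral_cong[OF refl])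
    fix x
    have "S x powr p = S x * g x"
      using S_nonneg[of x] pq by (cases "S x = 0") (auto simp: g_def powr_diff)
    then show "S x powr p * \<sigma> x = (\<Sum>i\<in>I. coef i * (indicator (T i) x * (g x * \<sigma> x)))"
      by (simp add: S_eq sum_distrib_right mult.assoc)
  qed
  also have "\<dots> = (\<Sum>i\<in>I. coef i * (LINT x:T i|M. g x * \<sigma> x))"
    unfolding set_lebesgue_integral_def using integrable_mult_indicator[OF sets(1) g_int]
    by (subst Bochner_Integration.integral_sum) auto
  also have "\<dots> = (\<Sum>l\<in>L. \<Sum>i\<in>{i \<in> I. col i = l}. coef i * (LINT x:T i|M. g x * \<sigma> x))"
    using I by (intro sum.group[symmetric]) auto
  also have "\<dots> \<le> (\<Sum>l\<in>L. ?K * X powr (1 / q))"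
    by (intro sum_mono part)
  finally have main: "X \<le> real (card L) * ?K * X powr (1 / q)" by simp
  show "X powr (1 / p) \<le> real (card L) * sparse_const A p q * B powr max 1 (1 / (p - 1)) * Y powr (1 / p)"
  proof (cases "X = 0")
    case True
    then show ?thesis using A pq by (auto simp: sparse_const_def)
  next
    case False
    then have "0 < X" using X_nonneg by simp
    have "X powr (1 / p) * X powr (1 / q) = X"
      using \<open>0 < X\<close> pq by (simp add: powr_add[symmetric])
    then have "X powr (1 / p) * X powr (1 / q) \<le> (real (card L) * ?K) * X powr (1 / q)"
      using main by simp
    then show ?thesis
      using \<open>0 < X\<close> by (simp add: mult.assoc)
  qed
qed


section \<open>Volumes of Carleson tents\<close>

lemma space_Vol [simp]: "space Vol = unit_ball"
  by (simp add: Vol_def)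

lemma sets_Vol: "sets Vol = sets (lebesgue_on unit_ball)"
  by (simp add: Vol_def)

lemma borel_subset_ball_sets_Vol: "A \<in> sets borel \<Longrightarrow> A \<subseteq> unit_ball \<Longrightarrow> A \<in> sets Vol"
  by (auto simp: sets_Vol sets_restrict_space_iff)

lemma measurable_Vol_borel: "f \<in> borel_measurable borel \<Longrightarrow> f \<in> borel_measurable Vol"
  unfolding Vol_def measurable_cong_sets[OF sets_uniform_measure refl]
  by (intro measurable_restrict_space1 measurable_completion) simp

lemma unit_ball_vol_neq_0: "0 \<le> x \<Longrightarrow> unit_ball_vol x \<noteq> 0"
  using unit_ball_vol_pos[of x] by linarith

lemma prob_space_Vol: "prob_space (Vol :: (complex ^ 'n::finite) measure)"
  unfolding Vol_def
proof (rule prob_space_uniform_measure)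
  show "emeasure (lebesgue_on unit_ball) (unit_ball :: (complex ^ 'n) set) \<noteq> 0"
    by (subst emeasure_restrict_space) (auto simp: emeasure_ball unit_ball_vol_neq_0)
  show "emeasure (lebesgue_on unit_ball) (unit_ball :: (complex ^ 'n) set) \<noteq> \<infinity>"
    by (subst emeasure_restrict_space) (auto simp: emeasure_ball)
qed

interpretation Vol: prob_space "Vol :: (complex ^ 'n::finite) measure"
  by (rule prob_space_Vol)

lemma measure_Vol:
  fixes A :: "(complex ^ 'n::finite) set"
  assumes "A \<in> sets borel" "A \<subseteq> unit_ball"
  shows "measure Vol A = measure lebesgue A / unit_ball_vol (2 * CARD('n))"
proof -
  have "measure Vol A = measure (lebesgue_on unit_ball) A / measure (lebesgue_on unit_ball) (unit_ball :: (complex ^ 'n) set)"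
    unfolding Vol_def using assms
    by (subst measure_uniform_measure)
      (auto simp: emeasure_restrict_space emeasure_ball unit_ball_vol_neq_0 sets_restrict_space_iff Int_absorb1)
  then show ?thesis
    using assms by (simp add: measure_restrict_space Int_absorb1 content_ball mult.commute)
qed

lemma hdot_scaleR_left: "hdot (a *\<^sub>R z) w = a *\<^sub>R hdot z w"
  by (simp add: hdot_def scaleR_sum_right)

lemma hdot_add_left: "hdot (z + z') w = hdot z w + hdot z' w"
  by (simp add: hdot_def sum.distrib ring_distribs)

lemma hdot_scale_left: "hdot (a *s z) w = a * hdot z w"
  by (simp add: hdot_def sum_distrib_left mult.assoc)

lemma norm_scale_vec: "norm (a *s z) = cmod a * norm z" for z :: "complex ^ 'n::finite"
  by (simp add: norm_vec_def norm_mult L2_set_right_distrib)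

lemma hdot_commute: "hdot z w = cnj (hdot w z)"
  by (simp add: hdot_def mult.commute)

lemma hdot_Cauchy_Schwarz: "cmod (hdot z w) \<le> norm z * norm w"
proof -
  have "cmod (hdot z w) \<le> (\<Sum>j\<in>UNIV. cmod (z $ j) * cmod (w $ j))"
    unfolding hdot_def by (rule order_trans[OF norm_sum]) (simp add: norm_mult)
  also have "\<dots> \<le> norm z * norm w"
    unfolding norm_vec_def using L2_set_mult_ineq[of "\<lambda>j. cmod (z $ j)" "\<lambda>j. cmod (w $ j)" UNIV] by simp
  finally show ?thesis .
qed

lemma continuous_on_hdot [continuous_intros]:
  fixes f g :: "'a::topological_space \<Rightarrow> complex ^ 'n::finite"
  shows "continuous_on S f \<Longrightarrow> continuous_on S g \<Longrightarrow> continuous_on S (\<lambda>x. hdot (f x) (g x))"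
  unfolding hdot_def by (intro continuous_intros)

lemma open_carleson_tent: "open (carleson_tent v)"
proof (cases "v = 0")
  case False
  have "open {w. cmod (1 - hdot ((1 / norm v) *\<^sub>R v) w) < 1 - norm v}"
    by (intro open_Collect_less continuous_intros)
  then have "open (unit_ball \<inter> {w. cmod (1 - hdot ((1 / norm v) *\<^sub>R v) w) < 1 - norm v})"
    by (intro open_Int) auto
  also have "unit_ball \<inter> {w. cmod (1 - hdot ((1 / norm v) *\<^sub>R v) w) < 1 - norm v} = carleson_tent v"
    using False by (auto simp: carleson_tent_def)
  finally show ?thesis .
qed (simp add: carleson_tent_def)

lemma carleson_tent_subset: "carleson_tent v \<subseteq> unit_ball"
  by (auto simp: carleson_tent_def)

lemma norm_diff_sqr_hdot: "(norm (z - w))\<^sup>2 = (norm z)\<^sup>2 + (norm w)\<^sup>2 - 2 * Re (hdot z w)"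
proof -
  have "complex_of_real ((norm (z - w))\<^sup>2) = hdot z z + hdot w w - (hdot z w + hdot w z)"
    unfolding hdot_self[symmetric] hdot_def sum.distrib[symmetric] sum_subtractf[symmetric]
    by (intro sum.cong) (auto simp: algebra_simps)
  then have "(norm (z - w))\<^sup>2 = Re (hdot z z + hdot w w - (hdot z w + hdot w z))"
    by (metis Re_complex_of_real)
  then show ?thesis
    using hdot_commute[of w z] by (simp add: hdot_self)
qed

lemma measure_packing:
  fixes S B :: "'a::euclidean_space set"
  assumes "S \<in> lmeasurable" "B \<in> lmeasurable" "finite X"
    and "\<And>x. x \<in> X \<Longrightarrow> (+) x ` S \<subseteq> B"
    and "\<And>x y. x \<in> X \<Longrightarrow> y \<in> X \<Longrightarrow> x \<noteq> y \<Longrightarrow> (+) x ` S \<inter> (+) y ` S = {}"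
  shows "real (card X) * measure lebesgue S \<le> measure lebesgue B"
proof -
  have lm: "(+) x ` S \<in> lmeasurable" for x using assms(1) by (rule measurable_translation)
  have "real (card X) * measure lebesgue S = (\<Sum>x\<in>X. measure lebesgue ((+) x ` S))"
    by (simp add: measure_translation)
  also have "\<dots> = measure lebesgue (\<Union>x\<in>X. (+) x ` S)"
  proof (rule measure_finite_Union[symmetric])
    show "(\<lambda>x. (+) x ` S) ` X \<subseteq> sets lebesgue" using lm by (auto dest: fmeasurableD)
    show "emeasure lebesgue ((+) x ` S) \<noteq> \<infinity>" for x
      using fmeasurableD2[OF lm[of x]] unfolding infinity_ennreal_def .
  qed (use assms in \<open>auto simp: disjoint_family_on_def\<close>)
  also have "\<dots> \<le> measure lebesgue B"
    using assms lm by (intro measure_mono_fmeasurable) (auto intro!: fmeasurableD fmeasurable.finite_UN)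
  finally show ?thesis .
qed

text \<open>
  With \<open>r = 1 - norm v\<close>, the tent lies within distance \<open>2 sqrt r\<close> of its centre \<open>\<zeta>\<close> on the sphere, but in
  the complex direction of \<open>\<zeta>\<close> it has only size \<open>r\<close>. Hence translates along \<open>\<zeta>\<close> by \<open>2 r (a + i b)\<close>
  with integers \<open>a\<close>, \<open>b\<close> are disjoint, and at least \<open>1 / r\<close> of them fit into a ball of radius
  \<open>10 sqrt r\<close>, whose volume is of order \<open>r^n\<close>.
\<close>

lemma carleson_tent_volume:
  fixes v :: "complex ^ 'n::finite"
  assumes "norm v < 1"
  shows "measure Vol (carleson_tent v) \<le> 100 ^ CARD('n) * (1 - norm v) ^ (CARD('n) + 1)"
proof (cases "v = 0")
  case True
  have "measure Vol (carleson_tent v) \<le> 1" by simp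
  also have "(1::real) \<le> 100 ^ CARD('n)" by simp
  finally show ?thesis using True by simp
next
  case False
  define \<zeta> where "\<zeta> = (1 / norm v) *\<^sub>R v"
  define r where "r = 1 - norm v"
  have r: "0 < r" "r < 1" using assms False by (auto simp: r_def)
  have \<zeta>: "norm \<zeta> = 1" "hdot \<zeta> \<zeta> = 1" using False by (auto simp: \<zeta>_def hdot_self)
  let ?S = "carleson_tent v"
  have S: "norm w < 1" "cmod (1 - hdot \<zeta> w) < r" "cmod (1 - hdot w \<zeta>) < r" if "w \<in> ?S" for w
  proof -
    show "norm w < 1" and *: "cmod (1 - hdot \<zeta> w) < r"
      using that False by (auto simp: carleson_tent_def \<zeta>_def r_def)
    have "1 - hdot w \<zeta> = cnj (1 - hdot \<zeta> w)" by (simp add: hdot_commute[of w])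
    then show "cmod (1 - hdot w \<zeta>) < r" using * by (metis complex_mod_cnj)
  qed
  define N where "N = nat \<lceil>1 / sqrt r\<rceil>"
  define tr where "tr = (\<lambda>(a, b). (complex_of_real (2 * r) * Complex (real a) (real b)) *s \<zeta>)"
  define X where "X = tr ` ({..<N} \<times> {..<N})"
  have N: "1 / sqrt r \<le> real N" "real N \<le> 2 / sqrt r"
  proof -
    show "1 / sqrt r \<le> real N" unfolding N_def by (simp add: of_nat_ceiling)
    have "1 \<le> 1 / sqrt r" using r by simp
    then have "real N \<le> 1 / sqrt r + 1" unfolding N_def by linarith
    also have "\<dots> \<le> 2 / sqrt r" using \<open>1 \<le> 1 / sqrt r\<close> by simp
    finally show "real N \<le> 2 / sqrt r" .
  qed
  have hdot_tr: "hdot (tr (a, b)) \<zeta> = complex_of_real (2 * r) * Complex (real a) (real b)" for a b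
    by (simp add: tr_def hdot_scale_left \<zeta>)
  have index_eq: "(a, b) = (a', b')"
    if "tr (a, b) + w = tr (a', b') + w'" "w \<in> ?S" "w' \<in> ?S" for a b a' b' w w'
  proof -
    have "hdot (tr (a, b)) \<zeta> + hdot w \<zeta> = hdot (tr (a', b')) \<zeta> + hdot w' \<zeta>"
      using that(1) by (simp add: hdot_add_left[symmetric])
    then have "complex_of_real (2 * r) * (Complex (real a) (real b) - Complex (real a') (real b')) = (1 - hdot w \<zeta>) - (1 - hdot w' \<zeta>)"
      unfolding hdot_tr by (simp add: algebra_simps)
    then have "2 * r * cmod (Complex (real a) (real b) - Complex (real a') (real b')) = cmod ((1 - hdot w \<zeta>) - (1 - hdot w' \<zeta>))"
      using r by (metis norm_mult norm_of_real abs_of_pos mult_pos_pos zero_less_numeral)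
    also have "\<dots> \<le> cmod (1 - hdot w \<zeta>) + cmod (1 - hdot w' \<zeta>)" by (rule norm_triangle_ineq4)
    also have "\<dots> < 2 * r" using S(3)[OF that(2)] S(3)[OF that(3)] by simp
    finally have "cmod (Complex (real a) (real b) - Complex (real a') (real b')) < 1" using r by simp
    then have "\<bar>real a - real a'\<bar> < 1" "\<bar>real b - real b'\<bar> < 1"
      using abs_Re_le_cmod[of "Complex (real a) (real b) - Complex (real a') (real b')"]
        abs_Im_le_cmod[of "Complex (real a) (real b) - Complex (real a') (real b')"] by simp_all
    then show ?thesis by auto
  qed
  have "?S \<noteq> {}"
  proof -
    define w where "w = (1 - r / 2) *\<^sub>R \<zeta>"
    have "hdot w \<zeta> = (1 - r / 2) *\<^sub>R hdot \<zeta> \<zeta>" unfolding w_def hdot_scaleR_left ..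
    then have "hdot \<zeta> w = of_real (1 - r / 2)"
      using \<zeta> by (subst hdot_commute) (simp add: scaleR_conv_of_real)
    then have "1 - hdot \<zeta> w = of_real (r / 2)" by simp
    then have "cmod (1 - hdot \<zeta> w) = r / 2" using r by (metis abs_of_pos half_gt_zero norm_of_real)
    moreover have "norm w < 1" using r \<zeta> by (simp add: w_def)
    ultimately have "w \<in> ?S" using False r by (simp add: carleson_tent_def \<zeta>_def r_def)
    then show ?thesis by blast
  qed
  then obtain w0 where w0: "w0 \<in> ?S" by blast
  have "inj_on tr ({..<N} \<times> {..<N})"
    using index_eq[OF _ w0 w0] by (auto simp: inj_on_def)
  then have card_X: "card X = N * N" and fin_X: "finite X"
    by (auto simp: X_def card_image card_cartesian_product)
  let ?B = "ball \<zeta> (10 * sqrt r)"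
  have lm: "?S \<in> lmeasurable"
    using open_carleson_tent carleson_tent_subset by (metis bounded_ball bounded_subset lmeasurable_open)
  have "real (card X) * measure lebesgue ?S \<le> measure lebesgue ?B"
  proof (rule measure_packing[OF lm _ fin_X])
    show "?B \<in> lmeasurable" by simp
    show "(+) x ` ?S \<inter> (+) y ` ?S = {}" if "x \<in> X" "y \<in> X" "x \<noteq> y" for x y
      using that index_eq unfolding X_def by fastforce
    show "(+) x ` ?S \<subseteq> ?B" if x: "x \<in> X" for x
    proof safe
      fix w assume w: "w \<in> ?S"
      obtain a b where ab: "x = tr (a, b)" "a < N" "b < N" using x by (auto simp: X_def)
      have "norm x = 2 * r * cmod (Complex (real a) (real b))"
        using r \<zeta> by (simp add: ab tr_def norm_mult norm_scale_vec)
      also have "\<dots> \<le> 2 * r * (real a + real b)"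
        using r cmod_le[of "Complex (real a) (real b)"] by (intro mult_left_mono) auto
      also have "\<dots> \<le> 2 * r * (2 / sqrt r + 2 / sqrt r)"
        using ab N r by (intro mult_left_mono add_mono) auto
      also have "\<dots> = 8 * sqrt r"
        using r by (simp add: field_simps)
      finally have nx: "norm x \<le> 8 * sqrt r" .
      have "(norm (w - \<zeta>))\<^sup>2 < (2 * sqrt r)\<^sup>2"
      proof -
        have "1 - Re (hdot w \<zeta>) < r"
          using S(3)[OF w] complex_Re_le_cmod[of "1 - hdot w \<zeta>"] by simp
        moreover have "(norm w)\<^sup>2 < 1" using S(1)[OF w] by (simp add: power_less_one_iff)
        ultimately show ?thesis
          using r \<zeta> by (simp add: norm_diff_sqr_hdot power_mult_distrib)
      qed
      then have "norm (w - \<zeta>) < 2 * sqrt r"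
        by (rule power2_less_imp_less) (use r in simp)
      then have "norm (x + w - \<zeta>) < 10 * sqrt r"
        using nx norm_triangle_ineq[of x "w - \<zeta>"] by (simp add: add_diff_eq)
      then show "x + w \<in> ?B" by (simp add: dist_norm norm_minus_commute)
    qed
  qed
  also have "measure lebesgue ?B = unit_ball_vol (2 * CARD('n)) * (100 ^ CARD('n) * r ^ CARD('n))"
    using r by (simp add: content_ball mult.commute[of _ 2] power_mult power_mult_distrib)
  finally have le: "real N * real N * measure lebesgue ?S \<le> unit_ball_vol (2 * CARD('n)) * (100 ^ CARD('n) * r ^ CARD('n))"
    by (simp add: card_X)
  have "measure lebesgue ?S = r * (1 / sqrt r * (1 / sqrt r) * measure lebesgue ?S)"
    using r by (simp add: field_simps)
  also have "\<dots> \<le> r * (real N * real N * measure lebesgue ?S)"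
    using N r by (intro mult_left_mono mult_right_mono mult_mono) auto
  also have "\<dots> \<le> r * (unit_ball_vol (2 * CARD('n)) * (100 ^ CARD('n) * r ^ CARD('n)))"
    using le r by (intro mult_left_mono) auto
  finally have "measure lebesgue ?S / unit_ball_vol (2 * CARD('n)) \<le> 100 ^ CARD('n) * r ^ (CARD('n) + 1)"
    by (simp add: divide_le_eq mult_ac)
  then show ?thesis
    using borel_open[OF open_carleson_tent[of v]] carleson_tent_subset by (subst measure_Vol) (auto simp: r_def)
qed

text \<open>
  The tent is centred in the direction \<open>\<zeta>\<close> of \<open>z\<close>. Both \<open>1 - norm z\<close> and the change from \<open>1 - hdot z w\<close>
  to \<open>1 - hdot \<zeta> w\<close> are at most \<open>t = \<bar>1 - hdot z w\<bar>\<close>, so the two points have tent distance at most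
  \<open>2 t < 3 t\<close> from \<open>\<zeta>\<close>. If \<open>3 t \<ge> 1\<close>, the whole ball, which is the tent over \<open>0\<close>, serves.
\<close>

lemma carleson_tent_two_points:
  fixes z w :: "complex ^ 'n::finite"
  assumes "norm z < 1" "norm w < 1"
  obtains v where "norm v < 1" "z \<in> carleson_tent v" "w \<in> carleson_tent v"
    "1 - norm v \<le> 3 * cmod (1 - hdot z w)"
proof -
  define t where "t = cmod (1 - hdot z w)"
  have "cmod (hdot z w) \<le> norm z * norm w" by (rule hdot_Cauchy_Schwarz)
  also have "\<dots> \<le> norm z" using assms by (simp add: mult_left_le)
  finally have zt: "1 - norm z \<le> t"
    unfolding t_def by (smt (verit) norm_one norm_triangle_ineq2)
  then have t: "0 < t" using assms by simp
  show thesis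
  proof (cases "3 * t < 1")
    case False
    show thesis by (rule that[of 0]) (use assms False in \<open>auto simp: carleson_tent_def t_def\<close>)
  next
    case True
    then have z: "z \<noteq> 0" using t by (auto simp: t_def hdot_def)
    define \<zeta> where "\<zeta> = (1 / norm z) *\<^sub>R z"
    have \<zeta>: "norm \<zeta> = 1" using z by (simp add: \<zeta>_def)
    define v where "v = (1 - 3 * t) *\<^sub>R \<zeta>"
    have v: "norm v = 1 - 3 * t" "v \<noteq> 0" "(1 / norm v) *\<^sub>R v = \<zeta>"
      using True \<zeta> by (auto simp: v_def)
    have "hdot \<zeta> z = (1 / norm z) *\<^sub>R hdot z z" unfolding \<zeta>_def hdot_scaleR_left ..
    then have "hdot \<zeta> z = of_real (norm z)"
      using z by (simp add: hdot_self power2_eq_square scaleR_conv_of_real)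
    then have "cmod (1 - hdot \<zeta> z) = 1 - norm z"
      using assms by (metis abs_of_pos diff_gt_0_iff_gt norm_of_real of_real_1 of_real_diff)
    then have 1: "cmod (1 - hdot \<zeta> z) < 3 * t" using zt t by simp
    have "hdot z w = of_real (norm z) * hdot \<zeta> w"
      using z unfolding \<zeta>_def hdot_scaleR_left by (simp add: scaleR_conv_of_real)
    then have "1 - hdot \<zeta> w = (1 - hdot z w) - of_real (1 - norm z) * hdot \<zeta> w"
      by (simp add: algebra_simps)
    then have "cmod (1 - hdot \<zeta> w) \<le> t + cmod (of_real (1 - norm z) * hdot \<zeta> w)"
      unfolding t_def by (metis norm_triangle_ineq4)
    also have "cmod (of_real (1 - norm z) * hdot \<zeta> w) \<le> (1 - norm z) * 1"
      using hdot_Cauchy_Schwarz[of \<zeta> w] assms \<zeta> unfolding norm_mult norm_of_real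
      by (intro mult_mono) auto
    finally have 2: "cmod (1 - hdot \<zeta> w) < 3 * t" using zt t by simp
    show thesis
      by (rule that[of v]) (use assms v 1 2 t in \<open>auto simp: carleson_tent_def t_def\<close>)
  qed
qed


section \<open>Dyadic tents and the Bergman kernel\<close>

lemma kube_subset_ball: "kube \<theta> D K \<subseteq> unit_ball"
  by (cases K) (auto simp: bergman_ball_def)

lemma tent_subset_ball: "tent \<theta> D K \<subseteq> unit_ball"
  unfolding tent_def using kube_subset_ball by blast

lemma kube_subset_tent: "kube \<theta> D K \<subseteq> tent \<theta> D K"
  by (auto simp: tent_def)

lemma countable_kubes: "countable (kubes D)"
  by (rule countable_subset[of _ UNIV]) auto

lemma kube_sets_borel:
  assumes "dyadic_structure \<theta> lam D" "K \<in> kubes D"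
  shows "kube \<theta> D K \<in> sets borel"
proof -
  have [measurable]: "(\<lambda>z :: complex ^ 'n. artanh (norm z)) \<in> borel_measurable borel"
    unfolding artanh_def by measurable
  have [measurable]: "radial_proj s \<in> borel_measurable borel" for s
    unfolding radial_proj_def[abs_def] by measurable
  obtain k j where K: "K = (k, j)" by (cases K)
  show ?thesis
  proof (cases "k = 0")
    case True
    have "kube \<theta> D K = unit_ball \<inter> {z \<in> space borel. artanh (norm z) \<le> \<theta>}"
      by (auto simp: K True bergman_ball_def bergman_dist_0)
    also have "\<dots> \<in> sets borel" by measurable
    finally show ?thesis .
  next
    case False
    then have [measurable]: "cell D k j \<in> sets borel"
      using assms by (auto simp: K dyadic_structure_def kubes_def)
    have "kube \<theta> D K = unit_ball \<inter> {z \<in> space borel. real k * \<theta> < artanh (norm z) \<and>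
        artanh (norm z) \<le> real (k + 1) * \<theta> \<and> radial_proj (real k * \<theta>) z \<in> cell D k j}"
      using False by (auto simp: K bergman_dist_0)
    also have "\<dots> \<in> sets borel" by measurable
    finally show ?thesis .
  qed
qed

lemma tent_sets_borel:
  assumes "dyadic_structure \<theta> lam D" "K \<in> kubes D"
  shows "tent \<theta> D K \<in> sets borel"
proof -
  have "countable {K' \<in> kubes D. descendant \<theta> D K' K}"
    by (rule countable_subset[OF _ countable_kubes]) auto
  then show ?thesis
    unfolding tent_def using kube_sets_borel[OF assms(1)] assms(2)
    by (intro sets.Un sets.countable_UN'') auto
qed

text \<open>Different generations occupy disjoint spherical shells, and within one shell the cells decide.\<close>

lemma disjoint_kubes:
  assumes "dyadic_structure \<theta> lam D" "0 < \<theta>"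
  shows "disjoint_family_on (kube \<theta> D) (kubes D)"
  unfolding disjoint_family_on_def
proof (intro ballI impI)
  have level: False if "k < k'" "z \<in> kube \<theta> D (k, j)" "z \<in> kube \<theta> D (k', j')" for k k' j j' z
  proof -
    have "bergman_dist 0 z \<le> real (k + 1) * \<theta>"
      using that(2) by (cases "k = 0") (simp_all add: bergman_ball_def)
    also have "\<dots> \<le> real k' * \<theta>" using that(1) assms(2) by (intro mult_right_mono) auto
    also have "\<dots> < bergman_dist 0 z" using that(1,3) by simp
    finally show False by simp
  qed
  fix K K' assume K: "K \<in> kubes D" "K' \<in> kubes D" and ne: "K \<noteq> K'"
  obtain k j k' j' where kj: "K = (k, j)" "K' = (k', j')" by (cases K, cases K')
  have False if z: "z \<in> kube \<theta> D K" "z \<in> kube \<theta> D K'" for z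
  proof -
    have "k = k'" using level[of k k' z j j'] level[of k' k z j' j] z unfolding kj by fastforce
    moreover from this have "k \<noteq> 0" using ne K by (auto simp: kubes_def kj)
    moreover have "cell D k j \<inter> cell D k j' = {}"
    proof -
      have "disjoint_family_on (cell D k) {1..num D k}"
      proof -
        have "1 \<le> k" using \<open>k \<noteq> 0\<close> by simp
        then show ?thesis using assms(1) unfolding dyadic_structure_def by meson
      qed
      moreover have "j \<in> {1..num D k}" "j' \<in> {1..num D k}" "j \<noteq> j'"
        using K ne \<open>k = k'\<close> \<open>k \<noteq> 0\<close> by (auto simp: kubes_def kj)
      ultimately show ?thesis by (simp add: disjoint_family_on_def)
    qed
    ultimately show False using z by (simp add: kj) blast
  qed
  then show "kube \<theta> D K \<inter> kube \<theta> D K' = {}" by blast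
qed

lemma norm_center_less_1:
  fixes D :: "'n::finite dyadic"
  assumes "0 < \<theta>"
  shows "norm (center \<theta> D K) < 1"
proof (cases K)
  case (Pair k j)
  have "norm (radial_proj s z) < 1" if "0 \<le> s" for s and z :: "complex ^ 'n"
    using that tanh_real_lt_1[of s] by (cases "z = 0") (auto simp: radial_proj_def)
  then show ?thesis using Pair assms by auto
qed

text \<open>
  Besides disjointness, nestedness and measurability, two properties of dyadic collections matter
  below: kubes are substantial parts of their tents, and the tents capture the size of the kernel.
  For the latter, a Carleson tent containing both points is enlarged to a dyadic tent.
\<close>

lemma dyadic_collection_kernel:
  fixes D :: "nat \<Rightarrow> 'n::finite dyadic"
  assumes D: "dyadic_collection \<theta> lam M D" and "0 < \<theta>"
  obtains A where "0 < A"
    "\<And>l K. l \<in> {1..M} \<Longrightarrow> K \<in> kubes (D l) \<Longrightarrow> 0 < measure Vol (tent \<theta> (D l) K)"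
    "\<And>l K. l \<in> {1..M} \<Longrightarrow> K \<in> kubes (D l) \<Longrightarrow>
       measure Vol (tent \<theta> (D l) K) \<le> A * measure Vol (kube \<theta> (D l) K)"
    "\<And>z w. norm z < 1 \<Longrightarrow> norm w < 1 \<Longrightarrow> \<exists>l\<in>{1..M}. \<exists>K\<in>kubes (D l).
       z \<in> tent \<theta> (D l) K \<and> w \<in> tent \<theta> (D l) K \<and>
       measure Vol (tent \<theta> (D l) K) \<le> A * cmod (1 - hdot z w) ^ (CARD('n) + 1)"
    "\<exists>l\<in>{1..M}. \<exists>K\<in>kubes (D l). tent \<theta> (D l) K = unit_ball"
proof -
  let ?n = "CARD('n) + 1"
  obtain A1 where A1: "0 < A1" "\<And>l K. l \<in> {1..M} \<Longrightarrow> K \<in> kubes (D l) \<Longrightarrow>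
        comparable A1 (measure Vol (kube \<theta> (D l) K)) (measure Vol (tent \<theta> (D l) K)) \<and>
        comparable A1 (measure Vol (tent \<theta> (D l) K)) ((1 - (norm (center \<theta> (D l) K))\<^sup>2) ^ ?n)"
    using D unfolding dyadic_collection_def by metis
  obtain A2 where A2: "0 < A2" "\<And>z. z \<in> unit_ball \<Longrightarrow> \<exists>l\<in>{1..M}. \<exists>K\<in>kubes (D l).
        carleson_tent z \<subseteq> tent \<theta> (D l) K \<and>
        comparable A2 (measure Vol (tent \<theta> (D l) K)) (measure Vol (carleson_tent z))"
    using D unfolding dyadic_collection_def by metis
  define A where "A = A1 + A2 * (100 ^ CARD('n) * 3 ^ ?n)"
  show thesis
  proof (rule that[of A])
    show "0 < A" using A1(1) A2(1) by (simp add: A_def add_pos_pos)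
  next
    fix l K assume lK: "l \<in> {1..M}" "K \<in> kubes (D l)"
    have "(norm (center \<theta> (D l) K))\<^sup>2 < 1"
      using norm_center_less_1[OF \<open>0 < \<theta>\<close>] by (simp add: power_less_one_iff)
    then have "0 < (1 - (norm (center \<theta> (D l) K))\<^sup>2) ^ ?n" by (intro zero_less_power) simp
    also have "\<dots> \<le> A1 * measure Vol (tent \<theta> (D l) K)" using A1(2)[OF lK] by (simp add: comparable_def)
    finally show "0 < measure Vol (tent \<theta> (D l) K)" using A1(1) by (simp add: zero_less_mult_iff)
    have "measure Vol (tent \<theta> (D l) K) \<le> A1 * measure Vol (kube \<theta> (D l) K)"
      using A1(2)[OF lK] by (simp add: comparable_def)
    also have "\<dots> \<le> A * measure Vol (kube \<theta> (D l) K)"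
      using A1 A2 by (intro mult_right_mono) (auto simp: A_def)
    finally show "measure Vol (tent \<theta> (D l) K) \<le> A * measure Vol (kube \<theta> (D l) K)" .
  next
    fix z w :: "complex ^ 'n" assume zw: "norm z < 1" "norm w < 1"
    let ?t = "cmod (1 - hdot z w)"
    obtain v where v: "norm v < 1" "z \<in> carleson_tent v" "w \<in> carleson_tent v" "1 - norm v \<le> 3 * ?t"
      using carleson_tent_two_points[OF zw] by blast
    obtain l K where lK: "l \<in> {1..M}" "K \<in> kubes (D l)" "carleson_tent v \<subseteq> tent \<theta> (D l) K"
      "comparable A2 (measure Vol (tent \<theta> (D l) K)) (measure Vol (carleson_tent v))"
      using A2(2)[of v] v by auto
    have "measure Vol (tent \<theta> (D l) K) \<le> A2 * measure Vol (carleson_tent v)"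
      using lK(4) by (simp add: comparable_def)
    also have "\<dots> \<le> A2 * (100 ^ CARD('n) * (1 - norm v) ^ ?n)"
      using A2(1) carleson_tent_volume[OF v(1)] by (intro mult_left_mono) auto
    also have "\<dots> \<le> A2 * (100 ^ CARD('n) * (3 * ?t) ^ ?n)"
      using A2(1) v by (intro mult_left_mono power_mono) auto
    also have "\<dots> = A2 * (100 ^ CARD('n) * 3 ^ ?n) * ?t ^ ?n"
      by (simp add: power_mult_distrib)
    also have "\<dots> \<le> A * ?t ^ ?n"
      using A1(1) by (intro mult_right_mono) (auto simp: A_def)
    finally show "\<exists>l\<in>{1..M}. \<exists>K\<in>kubes (D l). z \<in> tent \<theta> (D l) K \<and> w \<in> tent \<theta> (D l) K \<and>
       measure Vol (tent \<theta> (D l) K) \<le> A * ?t ^ ?n"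
      using lK v by blast
  next
    obtain l K where "l \<in> {1..M}" "K \<in> kubes (D l)" "carleson_tent 0 \<subseteq> tent \<theta> (D l) K"
      using A2(2)[of 0] by auto
    moreover have "carleson_tent 0 = (unit_ball :: (complex ^ 'n) set)" by (simp add: carleson_tent_def)
    ultimately show "\<exists>l\<in>{1..M}. \<exists>K\<in>kubes (D l). tent \<theta> (D l) K = unit_ball"
      using tent_subset_ball by (metis subset_antisym)
  qed
qed


section \<open>Powers of extended nonnegative reals\<close>

lemma ennpowr_ennreal: "0 \<le> x \<Longrightarrow> ennpowr (ennreal x) a = ennreal (x powr a)"
  by (simp add: ennpowr_def)

lemma ennpowr_mono:
  assumes "0 \<le> a" "x \<le> y"
  shows "ennpowr x a \<le> ennpowr y a"
proof (cases y)
  case (real s)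
  then obtain r where "x = ennreal r" "0 \<le> r" using assms(2) by (cases x) (auto simp: top_unique)
  then show ?thesis
    using real assms by (auto simp: ennpowr_ennreal intro!: ennreal_leI powr_mono2)
qed (simp add: ennpowr_def)

lemma ennpowr_inverse: "a \<noteq> 0 \<Longrightarrow> ennpowr (ennpowr x a) (1 / a) = x"
  by (cases x) (auto simp: ennpowr_ennreal powr_powr, simp add: ennpowr_def)

lemma ennpowr_inverse': "a \<noteq> 0 \<Longrightarrow> ennpowr (ennpowr x (1 / a)) a = x"
  using ennpowr_inverse[of "1 / a" x] by simp

text \<open>The power is monotone with a monotone inverse, hence it commutes with all suprema.\<close>

lemma ennpowr_SUP:
  assumes "0 < a"
  shows "ennpowr (SUP i\<in>I. x i) a = (SUP i\<in>I. ennpowr (x i) a)"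
proof (rule antisym)
  have "x i \<le> ennpowr (SUP i\<in>I. ennpowr (x i) a) (1 / a)" if "i \<in> I" for i
  proof -
    have "x i = ennpowr (ennpowr (x i) a) (1 / a)" using assms by (simp add: ennpowr_inverse)
    also have "\<dots> \<le> ennpowr (SUP i\<in>I. ennpowr (x i) a) (1 / a)"
      using assms that by (intro ennpowr_mono SUP_upper) auto
    finally show ?thesis .
  qed
  then have "ennpowr (SUP i\<in>I. x i) a \<le> ennpowr (ennpowr (SUP i\<in>I. ennpowr (x i) a) (1 / a)) a"
    using assms by (intro ennpowr_mono SUP_least) auto
  then show "ennpowr (SUP i\<in>I. x i) a \<le> (SUP i\<in>I. ennpowr (x i) a)"
    using assms by (simp add: ennpowr_inverse')
  show "(SUP i\<in>I. ennpowr (x i) a) \<le> ennpowr (SUP i\<in>I. x i) a"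
    using assms by (intro SUP_least ennpowr_mono SUP_upper) auto
qed

lemma ennpowr_eq_0_iff: "ennpowr x a = 0 \<longleftrightarrow> x = 0"
  by (cases x) (auto simp: ennpowr_ennreal, simp add: ennpowr_def)

lemma ennpowr_eq_top_iff: "ennpowr x a = top \<longleftrightarrow> x = top"
  by (simp add: ennpowr_def)


section \<open>Toeplitz operators\<close>

lemma hdot_measurable [measurable]: "hdot z \<in> borel_measurable Vol"
  by (intro measurable_Vol_borel borel_measurable_continuous_onI continuous_intros)

lemma toeplitz_integrand_measurable:
  assumes [measurable]: "u \<in> borel_measurable Vol" "f \<in> borel_measurable Vol"
  shows "toeplitz_integrand u f z \<in> borel_measurable Vol"
  unfolding toeplitz_integrand_def[abs_def] by measurable

lemma toeplitz_measurable:
  fixes u f :: "complex ^ 'n::finite \<Rightarrow> complex"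
  assumes [measurable]: "u \<in> borel_measurable Vol" "f \<in> borel_measurable Vol"
  shows "toeplitz u f \<in> borel_measurable Vol"
proof -
  have id: "(\<lambda>x :: complex ^ 'n. x) \<in> Vol \<rightarrow>\<^sub>M borel"
    by (rule measurable_Vol_borel) simp
  have [measurable]: "(\<lambda>p. hdot (fst p) (snd p)) \<in> borel_measurable ((Vol :: (complex ^ 'n) measure) \<Otimes>\<^sub>M Vol)"
    by (rule borel_measurable_continuous_Pair[OF measurable_compose[OF measurable_fst id]
          measurable_compose[OF measurable_snd id]])
      (intro continuous_on_hdot continuous_on_fst continuous_on_snd continuous_on_id)
  show ?thesis
    unfolding toeplitz_def[abs_def] toeplitz_integrand_def
    by (intro Vol.borel_measurable_lebesgue_integral) (simp add: split_beta')
qed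

lemma one_minus_norm_le_hdot: "norm z < 1 \<Longrightarrow> norm w < 1 \<Longrightarrow> 1 - norm z \<le> cmod (1 - hdot z w)"
proof -
  assume "norm z < 1" "norm w < 1"
  then have "cmod (hdot z w) \<le> norm z"
    using hdot_Cauchy_Schwarz[of z w] by (smt (verit) mult_left_le norm_ge_zero)
  then show ?thesis by (smt (verit) norm_one norm_triangle_ineq2)
qed

lemma toeplitz_integrable:
  fixes u f :: "complex ^ 'n::finite \<Rightarrow> complex"
  assumes [measurable]: "u \<in> borel_measurable Vol" and f: "integrable Vol f"
    and bound: "AE w in Vol. cmod (u w) \<le> b" and z: "norm z < 1"
  shows "integrable Vol (toeplitz_integrand u f z)"
proof (rule Bochner_Integration.integrable_bound)
  let ?d = "(1 - norm z) ^ (CARD('n) + 1)"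
  show "integrable Vol (\<lambda>w. b * cmod (f w) / ?d)" using f by auto
  have [measurable]: "f \<in> borel_measurable Vol" using f by auto
  show "toeplitz_integrand u f z \<in> borel_measurable Vol" by (rule toeplitz_integrand_measurable) measurable
  have "AE w in Vol. norm w < 1" by (intro AE_I2) (simp add: dist_norm)
  with bound show "AE w in Vol. norm (toeplitz_integrand u f z w) \<le> norm (b * cmod (f w) / ?d)"
  proof eventually_elim
    case (elim w)
    have "?d \<le> cmod (1 - hdot z w) ^ (CARD('n) + 1)"
      using z elim one_minus_norm_le_hdot[of z w] by (intro power_mono) auto
    then have "cmod (u w) * cmod (f w) / cmod (1 - hdot z w) ^ (CARD('n) + 1) \<le> b * cmod (f w) / ?d"
      using z elim
      by (intro frac_le mult_right_mono) (auto intro: mult_nonneg_nonneg order_trans[OF norm_ge_zero])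
    then show ?case
      unfolding toeplitz_integrand_def real_norm_def norm_divide norm_mult norm_power
      by (rule order_trans[OF _ abs_ge_self])
  qed
qed

text \<open>
  The family of all tents is exhausted by finite subfamilies \<open>F N\<close>. The dominating operators \<open>S N\<close>
  increase, and their norms are bounded independently of \<open>N\<close>; monotone convergence is used once in
  the variable \<open>w\<close> for the pointwise domination and once in \<open>z\<close> for the norms.
\<close>

lemma toeplitz_weighted_bound:
  fixes u f :: "complex ^ 'n::finite \<Rightarrow> complex" and \<sigma> :: "complex ^ 'n \<Rightarrow> real"
    and E T :: "'i \<Rightarrow> (complex ^ 'n) set" and c :: "'i \<Rightarrow> real" and col :: "'i \<Rightarrow> 'l"
  assumes pq: "1 < p" "1 < q" "1 / p + 1 / q = 1"
    and I: "countable I" "finite L" "\<And>i. i \<in> I \<Longrightarrow> col i \<in> L"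
    and col: "\<And>l. l \<in> L \<Longrightarrow> laminar (T ` {i \<in> I. col i = l})"
       "\<And>l. l \<in> L \<Longrightarrow> disjoint_family_on E {i \<in> I. col i = l}"
    and sets: "\<And>i. i \<in> I \<Longrightarrow> T i \<in> sets Vol" "\<And>i. i \<in> I \<Longrightarrow> E i \<in> sets Vol"
    and sub: "\<And>i. i \<in> I \<Longrightarrow> E i \<subseteq> T i"
    and sparse: "\<And>i. i \<in> I \<Longrightarrow> 0 < measure Vol (T i)" "\<And>i. i \<in> I \<Longrightarrow> measure Vol (T i) \<le> A * measure Vol (E i)"
    and kernel: "\<And>z w. norm z < 1 \<Longrightarrow> norm w < 1 \<Longrightarrow> \<exists>i\<in>I. z \<in> T i \<and> w \<in> T i \<and>
       measure Vol (T i) \<le> A * cmod (1 - hdot z w) ^ (CARD('n) + 1)"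
    and \<sigma>: "integrable Vol \<sigma>" "\<And>x. 0 < \<sigma> x" and \<tau>: "integrable Vol \<tau>" "\<And>x. \<tau> x = \<sigma> x powr (1 - q)"
    and c: "\<And>i. i \<in> I \<Longrightarrow> 0 \<le> c i" and A: "0 < A"
    and B: "\<And>i. i \<in> I \<Longrightarrow> c i powr min 1 (p - 1) * ((LINT x:T i|Vol. \<sigma> x) / measure Vol (T i))
          * ((LINT x:T i|Vol. \<tau> x) / measure Vol (T i)) powr (p - 1) \<le> B" "0 \<le> B"
    and u: "u \<in> borel_measurable Vol" "\<And>i. i \<in> I \<Longrightarrow> AE w in Vol. w \<in> T i \<longrightarrow> cmod (u w) \<le> c i"
    and f[measurable]: "f \<in> borel_measurable Vol" and f_int: "integrable Vol f" "integrable Vol (\<lambda>x. cmod (f x) powr p * \<sigma> x)"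
    and T_int: "\<And>z. norm z < 1 \<Longrightarrow> integrable Vol (toeplitz_integrand u f z)"
  shows "(\<integral>\<^sup>+z. ennreal (cmod (toeplitz u f z) powr p * \<sigma> z) \<partial>Vol)
    \<le> ennreal ((A * (real (card L) * sparse_const A p q * B powr max 1 (1 / (p - 1))
         * (LINT x|Vol. cmod (f x) powr p * \<sigma> x) powr (1 / p))) powr p)"
proof -
  note [measurable] = u(1)
  have [measurable]: "\<sigma> \<in> borel_measurable Vol" using \<sigma> by auto
  have "I \<noteq> {}" using kernel[of 0 0] by auto
  define e where "e = from_nat_into I"
  have e: "e k \<in> I" for k unfolding e_def by (rule from_nat_into) fact
  have e_surj: "\<exists>k. i = e k" if "i \<in> I" for i
    unfolding e_def using from_nat_into_surj[OF I(1) that] by metis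
  define F where "F N = e ` {..<N}" for N
  have F: "finite (F N)" "F N \<subseteq> I" "i \<in> F N \<Longrightarrow> i \<in> I" for N i using e by (auto simp: F_def)
  have F_mono: "F N \<subseteq> F N'" if "N \<le> N'" for N N' using that by (auto simp: F_def)
  define m where "m i = measure Vol (T i)" for i
  define S where "S N z = (\<Sum>i\<in>F N. c i / m i * (LINT w:T i|Vol. cmod (f w)) * indicator (T i) z)" for N z
  define R where "R = real (card L) * sparse_const A p q * B powr max 1 (1 / (p - 1))
         * (LINT x|Vol. cmod (f x) powr p * \<sigma> x) powr (1 / p)"
  have S_nonneg: "0 \<le> S N z" for N z
    unfolding S_def using c F(3) by (intro sum_nonneg mult_nonneg_nonneg divide_nonneg_nonneg set_integral_nonneg_all) (auto simp: m_def)
  have S_mono: "S N z \<le> S N' z" if "N \<le> N'" for N N' z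
    unfolding S_def using c F(3) F(1) F_mono[OF that]
    by (intro sum_mono2 mult_nonneg_nonneg divide_nonneg_nonneg set_integral_nonneg_all) (auto simp: m_def)
  have S_bound: "integrable Vol (\<lambda>x. S N x powr p * \<sigma> x)" "(LINT x|Vol. S N x powr p * \<sigma> x) powr (1 / p) \<le> R" for N
  proof -
    have fam: "laminar (T ` {i \<in> F N. col i = l})" "disjoint_family_on E {i \<in> F N. col i = l}" if "l \<in> L" for l
    proof -
      have "{i \<in> F N. col i = l} \<subseteq> {i \<in> I. col i = l}" using F(3) by auto
      then show "laminar (T ` {i \<in> F N. col i = l})" "disjoint_family_on E {i \<in> F N. col i = l}"
        using col[OF that] by (auto intro: laminar_subset disjoint_family_on_mono)
    qed
    show "integrable Vol (\<lambda>x. S N x powr p * \<sigma> x)" "(LINT x|Vol. S N x powr p * \<sigma> x) powr (1 / p) \<le> R"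
      unfolding S_def m_def R_def
      by (rule sparse_operator_bound[OF pq F(1) I(2) I(3)[OF F(3)] fam sets[OF F(3)] sub[OF F(3)] sparse[OF F(3)]
            \<sigma> \<tau> c[OF F(3)] A B(1)[OF F(3)] B(2)]; use f_int in simp)+
  qed
  have pointwise: "ennreal (cmod (toeplitz u f z)) \<le> (SUP N. ennreal (A * S N z))" if z: "norm z < 1" for z
  proof -
    define G where "G N w = (\<Sum>i\<in>F N. ennreal (A / m i) * indicator (T i) z * (ennreal (cmod (u w) * cmod (f w)) * indicator (T i) w))" for N w
    have [measurable]: "G N \<in> borel_measurable Vol" for N
      unfolding G_def using sets(1)[OF F(3)] by (intro borel_measurable_sum borel_measurable_times borel_measurable_indicator) auto
    have "ennreal (cmod (toeplitz u f z)) \<le> (\<integral>\<^sup>+w. ennreal (cmod (toeplitz_integrand u f z w)) \<partial>Vol)"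
      unfolding toeplitz_def by (rule integral_norm_bound_ennreal[OF T_int[OF z]])
    also have "\<dots> \<le> (\<integral>\<^sup>+w. (SUP N. G N w) \<partial>Vol)"
    proof (rule nn_integral_mono)
      fix w :: "complex ^ 'n" assume "w \<in> space Vol"
      then have w: "norm w < 1" by (simp add: dist_norm)
      let ?k = "cmod (1 - hdot z w) ^ (CARD('n) + 1)"
      obtain i where i: "i \<in> I" "z \<in> T i" "w \<in> T i" "m i \<le> A * ?k" using kernel[OF z w] by (auto simp: m_def)
      obtain k where k: "i = e k" using e_surj[OF i(1)] by blast
      have iF: "i \<in> F (Suc k)" by (auto simp: F_def k)
      have "0 < m i" using sparse(1)[OF i(1)] by (simp add: m_def)
      have "0 < ?k" using one_minus_norm_le_hdot[OF z w] z by (intro zero_less_power) linarith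
      then have "1 / ?k \<le> A / m i" using i(4) \<open>0 < m i\<close> by (simp add: field_simps)
      have "cmod (toeplitz_integrand u f z w) = 1 / ?k * (cmod (u w) * cmod (f w))"
        by (simp add: toeplitz_integrand_def norm_divide norm_mult norm_power)
      also have "\<dots> \<le> A / m i * (cmod (u w) * cmod (f w))"
        using \<open>1 / ?k \<le> A / m i\<close> by (intro mult_right_mono) auto
      finally have "ennreal (cmod (toeplitz_integrand u f z w)) \<le>
          ennreal (A / m i) * indicator (T i) z * (ennreal (cmod (u w) * cmod (f w)) * indicator (T i) w)"
        using i A \<open>0 < m i\<close> by (simp add: ennreal_mult[symmetric] ennreal_leI)
      also have "\<dots> \<le> G (Suc k) w"
        unfolding G_def using iF F(1) by (intro member_le_sum) auto
      also have "\<dots> \<le> (SUP N. G N w)" by (intro SUP_upper) auto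
      finally show "ennreal (cmod (toeplitz_integrand u f z w)) \<le> (SUP N. G N w)" .
    qed
    also have "\<dots> = (SUP N. \<integral>\<^sup>+w. G N w \<partial>Vol)"
    proof (rule nn_integral_monotone_convergence_SUP)
      show "incseq G"
        unfolding incseq_def le_fun_def G_def using F(1) F_mono by (intro allI impI sum_mono2) auto
    qed measurable
    also have "\<dots> \<le> (SUP N. ennreal (A * S N z))"
    proof (rule SUP_mono', goal_cases)
      case (1 N)
      have "(\<integral>\<^sup>+w. G N w \<partial>Vol) = (\<Sum>i\<in>F N. ennreal (A / m i) * indicator (T i) z * (\<integral>\<^sup>+w\<in>T i. ennreal (cmod (u w) * cmod (f w)) \<partial>Vol))"
        unfolding G_def using sets(1)[OF F(3)]
        by (subst nn_integral_sum) (auto intro!: sum.cong nn_integral_cmult)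
      also have "\<dots> \<le> (\<Sum>i\<in>F N. ennreal (A / m i) * indicator (T i) z * ennreal (c i * (LINT w:T i|Vol. cmod (f w))))"
      proof (intro sum_mono mult_left_mono)
        fix i assume "i \<in> F N"
        then have i: "i \<in> I" by (rule F(3))
        note [measurable] = sets(1)[OF i]
        have "(\<integral>\<^sup>+w\<in>T i. ennreal (cmod (u w) * cmod (f w)) \<partial>Vol)
            \<le> (\<integral>\<^sup>+w. ennreal (c i) * (ennreal (cmod (f w)) * indicator (T i) w) \<partial>Vol)"
        proof (rule nn_integral_mono_AE)
          show "AE w in Vol. ennreal (cmod (u w) * cmod (f w)) * indicator (T i) w
              \<le> ennreal (c i) * (ennreal (cmod (f w)) * indicator (T i) w)"
            using u(2)[OF i]
            by eventually_elim (auto simp: indicator_def ennreal_mult[symmetric] c[OF i] intro!: ennreal_leI mult_right_mono)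
        qed
        also have "\<dots> = ennreal (c i) * (\<integral>\<^sup>+w\<in>T i. ennreal (cmod (f w)) \<partial>Vol)"
          by (rule nn_integral_cmult) measurable
        also have "\<dots> = ennreal (c i * (LINT w:T i|Vol. cmod (f w)))"
          using f_int c[OF i] sets(1)[OF i]
          by (subst set_nn_integral_eq_set_integral) (auto simp: ennreal_mult set_integral_nonneg_all)
        finally show "(\<integral>\<^sup>+w\<in>T i. ennreal (cmod (u w) * cmod (f w)) \<partial>Vol) \<le> ennreal (c i * (LINT w:T i|Vol. cmod (f w)))" .
      qed auto
      also have "\<dots> = (\<Sum>i\<in>F N. ennreal (A * (c i / m i * (LINT w:T i|Vol. cmod (f w)) * indicator (T i) z)))"
      proof (intro sum.cong refl)
        fix i assume "i \<in> F N"
        then have "0 \<le> c i" "0 < m i" using c sparse F(3) by (auto simp: m_def)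
        then show "ennreal (A / m i) * indicator (T i) z * ennreal (c i * (LINT w:T i|Vol. cmod (f w)))
            = ennreal (A * (c i / m i * (LINT w:T i|Vol. cmod (f w)) * indicator (T i) z))"
          using A by (auto simp: indicator_def ennreal_mult[symmetric] set_integral_nonneg_all)
      qed
      also have "\<dots> = ennreal (A * S N z)"
        unfolding S_def sum_distrib_left using c F(3) A
        by (intro sum_ennreal mult_nonneg_nonneg divide_nonneg_nonneg set_integral_nonneg_all) (auto simp: m_def)
      finally show ?case .
    qed
    finally show ?thesis .
  qed
  have "(\<integral>\<^sup>+z. ennreal (cmod (toeplitz u f z) powr p * \<sigma> z) \<partial>Vol)
      \<le> (\<integral>\<^sup>+z. (SUP N. ennreal ((A * S N z) powr p * \<sigma> z)) \<partial>Vol)"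
  proof (rule nn_integral_mono)
    fix z :: "complex ^ 'n" assume "z \<in> space Vol"
    then have z: "norm z < 1" by (simp add: dist_norm)
    have "ennreal (cmod (toeplitz u f z) powr p * \<sigma> z) = ennpowr (ennreal (cmod (toeplitz u f z))) p * ennreal (\<sigma> z)"
      using \<sigma>(2)[of z] by (simp add: ennpowr_ennreal ennreal_mult)
    also have "\<dots> \<le> ennpowr (SUP N. ennreal (A * S N z)) p * ennreal (\<sigma> z)"
      using pq pointwise[OF z] by (intro mult_right_mono ennpowr_mono) auto
    also have "\<dots> = (SUP N. ennpowr (ennreal (A * S N z)) p * ennreal (\<sigma> z))"
      using pq by (simp add: ennpowr_SUP SUP_mult_right_ennreal)
    also have "\<dots> = (SUP N. ennreal ((A * S N z) powr p * \<sigma> z))"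
    proof (intro arg_cong[where f = Sup] image_cong refl)
      fix N
      have "0 \<le> A * S N z" using A S_nonneg by simp
      then show "ennpowr (ennreal (A * S N z)) p * ennreal (\<sigma> z) = ennreal ((A * S N z) powr p * \<sigma> z)"
        using \<sigma>(2)[of z] by (subst ennpowr_ennreal) (auto simp: ennreal_mult')
    qed
    finally show "ennreal (cmod (toeplitz u f z) powr p * \<sigma> z) \<le> (SUP N. ennreal ((A * S N z) powr p * \<sigma> z))" .
  qed
  also have "\<dots> = (SUP N. \<integral>\<^sup>+z. ennreal ((A * S N z) powr p * \<sigma> z) \<partial>Vol)"
  proof (rule nn_integral_monotone_convergence_SUP)
    show "incseq (\<lambda>N z. ennreal ((A * S N z) powr p * \<sigma> z))"
      unfolding incseq_def le_fun_def using A S_nonneg S_mono \<sigma>(2) pq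
      by (intro allI impI ennreal_leI mult_right_mono powr_mono2 mult_left_mono) (auto simp: less_imp_le)
    show "(\<lambda>z. ennreal ((A * S N z) powr p * \<sigma> z)) \<in> borel_measurable Vol" for N
      using borel_measurable_integrable[OF S_bound(1)[of N]] A S_nonneg by (simp add: powr_mult mult.assoc)
  qed
  also have "\<dots> \<le> ennreal ((A * R) powr p)"
  proof (rule SUP_least)
    fix N
    define X where "X = (LINT x|Vol. S N x powr p * \<sigma> x)"
    have "0 \<le> X" unfolding X_def using \<sigma>(2) by (intro integral_nonneg_AE) (auto simp: less_imp_le)
    have "(\<integral>\<^sup>+z. ennreal ((A * S N z) powr p * \<sigma> z) \<partial>Vol) = (\<integral>\<^sup>+z. ennreal (A powr p * (S N z powr p * \<sigma> z)) \<partial>Vol)"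
      using A S_nonneg by (simp add: powr_mult mult.assoc)
    also have "\<dots> = ennreal (LINT z|Vol. A powr p * (S N z powr p * \<sigma> z))"
      using S_bound(1)[of N] \<sigma>(2) by (intro nn_integral_eq_integral) (auto simp: less_imp_le)
    also have "\<dots> = ennreal (A powr p * X)" by (simp add: X_def)
    also have "X = (X powr (1 / p)) powr p" using \<open>0 \<le> X\<close> pq by (simp add: powr_powr)
    also have "ennreal (A powr p * \<dots>) \<le> ennreal (A powr p * R powr p)"
      using S_bound(2)[of N] pq by (intro ennreal_leI mult_left_mono powr_mono2) (auto simp: X_def)
    also have "A powr p * R powr p = (A * R) powr p"
    proof -
      have "0 \<le> R" using S_bound(2)[of N] powr_ge_zero order_trans by blast
      then show ?thesis using A by (simp add: powr_mult)
    qed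
    finally show "(\<integral>\<^sup>+z. ennreal ((A * S N z) powr p * \<sigma> z) \<partial>Vol) \<le> ennreal ((A * R) powr p)" .
  qed
  finally show ?thesis unfolding R_def .
qed

text \<open>
  Additivity holds because the integrals converge at every point of the ball, so everything
  reduces to integrability and one norm inequality.
\<close>

lemma toeplitz_bounded_onI:
  fixes u :: "complex ^ 'n::finite \<Rightarrow> complex"
  assumes u: "u \<in> borel_measurable Vol"
    and integrable: "\<And>f z. f \<in> Lp p \<sigma> \<Longrightarrow> norm z < 1 \<Longrightarrow> integrable Vol (toeplitz_integrand u f z)"
    and bound: "\<And>f. f \<in> Lp p \<sigma> \<Longrightarrow> Lp_norm p \<sigma> (toeplitz u f) \<le> R * Lp_norm p \<sigma> f"
    and "R < \<infinity>"
  shows "toeplitz_defined_on u (Lp p \<sigma>) \<and> bounded_on_Lp p \<sigma> (toeplitz u) \<and> op_norm p \<sigma> (toeplitz u) \<le> R"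
proof -
  have op: "op_norm p \<sigma> (toeplitz u) \<le> R"
    unfolding op_norm_def
  proof (rule SUP_least, clarify)
    fix f assume f: "f \<in> Lp p \<sigma>" "Lp_norm p \<sigma> f \<le> 1"
    have "Lp_norm p \<sigma> (toeplitz u f) \<le> R * Lp_norm p \<sigma> f" by (rule bound[OF f(1)])
    also have "\<dots> \<le> R * 1" using f(2) by (intro mult_left_mono) auto
    finally show "Lp_norm p \<sigma> (toeplitz u f) \<le> R" by simp
  qed
  have "toeplitz u f \<in> Lp p \<sigma>" if f: "f \<in> Lp p \<sigma>" for f
  proof -
    have "Lp_norm p \<sigma> f < \<infinity>" "f \<in> borel_measurable Vol" using f by (auto simp: Lp_def)
    then have "R * Lp_norm p \<sigma> f < \<infinity>" using \<open>R < \<infinity>\<close> by (simp add: ennreal_mult_less_top)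
    then show ?thesis
      using bound[OF f] toeplitz_measurable[OF u] \<open>f \<in> borel_measurable Vol\<close> by (auto simp: Lp_def)
  qed
  moreover have "AE z in Vol. toeplitz u (\<lambda>w. a * f w + b * g w) z = a * toeplitz u f z + b * toeplitz u g z"
    if fg: "f \<in> Lp p \<sigma>" "g \<in> Lp p \<sigma>" for f g a b
  proof (rule AE_I2)
    fix z :: "complex ^ 'n" assume "z \<in> space Vol"
    then have z: "norm z < 1" by (simp add: dist_norm)
    have "toeplitz_integrand u (\<lambda>w. a * f w + b * g w) z
        = (\<lambda>w. a * toeplitz_integrand u f z w + b * toeplitz_integrand u g z w)"
      by (simp add: toeplitz_integrand_def fun_eq_iff add_divide_distrib ring_distribs mult_ac)
    then show "toeplitz u (\<lambda>w. a * f w + b * g w) z = a * toeplitz u f z + b * toeplitz u g z"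
      using integrable[OF fg(1) z] integrable[OF fg(2) z] by (simp add: toeplitz_def)
  qed
  moreover have "op_norm p \<sigma> (toeplitz u) < \<infinity>" using op \<open>R < \<infinity>\<close> by (rule order.strict_trans1)
  ultimately show ?thesis
    using integrable op unfolding bounded_on_Lp_def toeplitz_defined_on_def by (auto simp: dist_norm)
qed

lemma AE_le_Linf_norm:
  assumes "A \<in> sets Vol"
  shows "AE w in Vol. w \<in> A \<longrightarrow> ennreal (cmod (u w)) \<le> Linf_norm A u"
proof -
  have "AE w in restrict_space Vol A. ennreal (cmod (u w)) \<le> Linf_norm A u"
    unfolding Linf_norm_def by (rule esssup_AE)
  moreover have "A \<inter> unit_ball = A" using sets.sets_into_space[OF assms] by auto
  ultimately show ?thesis using assms by (subst (asm) AE_restrict_space_iff) auto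
qed

lemma Linf_norm_mono:
  assumes "A \<in> sets Vol" "B \<in> sets Vol" "A \<subseteq> B" and [measurable]: "u \<in> borel_measurable Vol"
  shows "Linf_norm A u \<le> Linf_norm B u"
  unfolding Linf_norm_def[of A]
proof (rule esssup_I)
  show "(\<lambda>z. ennreal (cmod (u z))) \<in> borel_measurable (restrict_space Vol A)"
    by (intro measurable_restrict_space1) measurable
  have "AE w in Vol. w \<in> A \<longrightarrow> ennreal (cmod (u w)) \<le> Linf_norm B u"
    using AE_le_Linf_norm[OF assms(2), of u] assms(3) by (auto elim: eventually_mono)
  moreover have "A \<inter> unit_ball = A" using sets.sets_into_space[OF assms(1)] by auto
  ultimately show "AE w in restrict_space Vol A. ennreal (cmod (u w)) \<le> Linf_norm B u"
    using assms(1) by (subst AE_restrict_space_iff) auto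
qed

text \<open>
  A vanishing symbol is a case of its own: the weight may then be so bad that functions of the
  weighted space are not integrable.
\<close>

lemma toeplitz_zero_symbol:
  assumes "AE w in Vol. u w = 0" and [measurable]: "u \<in> borel_measurable Vol" "f \<in> borel_measurable Vol"
  shows "integrable Vol (toeplitz_integrand u f z)" "toeplitz u f z = 0"
proof -
  have *: "AE w in Vol. toeplitz_integrand u f z w = 0"
    using assms(1) by eventually_elim (simp add: toeplitz_integrand_def)
  have [measurable]: "toeplitz_integrand u f z \<in> borel_measurable Vol"
    by (rule toeplitz_integrand_measurable) measurable
  show "integrable Vol (toeplitz_integrand u f z)"
    by (subst integrable_cong_AE[OF _ _ *]) auto
  show "toeplitz u f z = 0"
    unfolding toeplitz_def by (subst integral_cong_AE[OF _ _ *]) auto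
qed

lemma nn_integral_pos_Vol:
  fixes h :: "complex ^ 'n::finite \<Rightarrow> real"
  assumes "AE z in Vol. 0 < h z" and [measurable]: "h \<in> borel_measurable Vol"
  shows "(\<integral>\<^sup>+z. ennreal (h z) \<partial>Vol) \<noteq> 0"
proof
  assume "(\<integral>\<^sup>+z. ennreal (h z) \<partial>Vol) = 0"
  then have "AE z in Vol. ennreal (h z) = 0" by (subst (asm) nn_integral_0_iff_AE) auto
  with assms(1) have "AE z in Vol. 0 < h z \<and> ennreal (h z) = 0" by (rule AE_conjI)
  then have "AE z :: complex ^ 'n in Vol. False" by (rule eventually_mono) (auto simp: ennreal_eq_0_iff)
  then show False by simp
qed

lemma avg_eq:
  assumes "AE z in Vol. h z = h' z" "integrable Vol h'" "\<And>z. 0 \<le> h' z" "A \<in> sets Vol" "0 < measure Vol A"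
  shows "avg A h = ennreal ((LINT z:A|Vol. h' z) / measure Vol A)"
proof -
  have "(\<integral>\<^sup>+z\<in>A. ennreal (h z) \<partial>Vol) = (\<integral>\<^sup>+z\<in>A. ennreal (h' z) \<partial>Vol)"
    using assms(1) by (intro nn_integral_cong_AE) (auto elim: eventually_mono)
  also have "\<dots> = ennreal (LINT z:A|Vol. h' z)"
    using assms by (intro set_nn_integral_eq_set_integral)
  finally show ?thesis
    using assms by (simp add: avg_def Vol.emeasure_eq_measure divide_ennreal set_integral_nonneg_all)
qed

lemma avg_ball:
  fixes h :: "complex ^ 'n::finite \<Rightarrow> real"
  shows "avg unit_ball h = (\<integral>\<^sup>+z. ennreal (h z) \<partial>Vol)"
proof -
  have "emeasure Vol (unit_ball :: (complex ^ 'n) set) = 1" using Vol.emeasure_space_1 by simp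
  moreover have "(\<integral>\<^sup>+z\<in>unit_ball. ennreal (h z) \<partial>Vol) = (\<integral>\<^sup>+z. ennreal (h z) \<partial>Vol)"
    by (intro nn_integral_cong) (auto simp: indicator_def)
  ultimately show ?thesis by (simp add: avg_def divide_ennreal_def)
qed

theorem theorem1p8:
  fixes p \<theta>\<^sub>0 lam\<^sub>0 :: real and M :: nat and D :: "nat \<Rightarrow> 'n::finite dyadic"
  assumes "1 < p"
    and "0 < \<theta>\<^sub>0" and "0 < lam\<^sub>0"
    and "dyadic_collection \<theta>\<^sub>0 lam\<^sub>0 M D"
  shows "\<exists>C::real. 0 < C \<and>
    (\<forall>u\<in>Linf. \<forall>\<sigma>\<in>uB \<theta>\<^sub>0 M D u (min 1 (p - 1)) p.
       toeplitz_defined_on u (Lp p \<sigma>) \<and>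
       bounded_on_Lp p \<sigma> (toeplitz u) \<and>
       op_norm p \<sigma> (toeplitz u)
         \<le> ennreal C * ennpowr (uB_char \<theta>\<^sub>0 M D u (min 1 (p - 1)) p \<sigma>) (max 1 (1 / (p - 1))))"
proof -
  define q where "q = p / (p - 1)"
  define s where "s = min 1 (p - 1)"
  define \<beta> where "\<beta> = max 1 (1 / (p - 1))"
  have pq: "1 < p" "1 < q" "1 / p + 1 / q = 1"
    using \<open>1 < p\<close> by (auto simp: q_def field_simps)
  obtain A where A: "0 < A"
    and tent_pos: "\<And>l K. l \<in> {1..M} \<Longrightarrow> K \<in> kubes (D l) \<Longrightarrow> 0 < measure Vol (tent \<theta>\<^sub>0 (D l) K)"
    and tent_kube: "\<And>l K. l \<in> {1..M} \<Longrightarrow> K \<in> kubes (D l) \<Longrightarrow>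
       measure Vol (tent \<theta>\<^sub>0 (D l) K) \<le> A * measure Vol (kube \<theta>\<^sub>0 (D l) K)"
    and kernel: "\<And>z w. norm z < 1 \<Longrightarrow> norm w < 1 \<Longrightarrow> \<exists>l\<in>{1..M}. \<exists>K\<in>kubes (D l).
       z \<in> tent \<theta>\<^sub>0 (D l) K \<and> w \<in> tent \<theta>\<^sub>0 (D l) K \<and>
       measure Vol (tent \<theta>\<^sub>0 (D l) K) \<le> A * cmod (1 - hdot z w) ^ (CARD('n) + 1)"
    and root: "\<exists>l\<in>{1..M}. \<exists>K\<in>kubes (D l). tent \<theta>\<^sub>0 (D l) K = unit_ball"
    using dyadic_collection_kernel[OF assms(4,2)] by metis
  have struct: "dyadic_structure \<theta>\<^sub>0 lam\<^sub>0 (D l)" if "l \<in> {1..M}" for l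
    using assms(4) that by (auto simp: dyadic_collection_def)
  have lam: "laminar (tent \<theta>\<^sub>0 (D l) ` kubes (D l))" if "l \<in> {1..M}" for l
    using assms(4) that unfolding dyadic_collection_def laminar_def by blast
  define I where "I = (SIGMA l:{1..M}. kubes (D l))"
  define T where "T i = tent \<theta>\<^sub>0 (D (fst i)) (snd i)" for i
  define E where "E i = kube \<theta>\<^sub>0 (D (fst i)) (snd i)" for i
  have T_sets: "T i \<in> sets Vol" and E_sets: "E i \<in> sets Vol" if i: "i \<in> I" for i
  proof -
    have l: "fst i \<in> {1..M}" and K: "snd i \<in> kubes (D (fst i))" using i by (auto simp: I_def)
    show "T i \<in> sets Vol" "E i \<in> sets Vol"
      unfolding T_def E_def
      by (intro borel_subset_ball_sets_Vol tent_subset_ball kube_subset_ball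
          tent_sets_borel[OF struct[OF l] K] kube_sets_borel[OF struct[OF l] K])+
  qed
  have E_sub: "E i \<subseteq> T i" if "i \<in> I" for i
    unfolding T_def E_def by (rule kube_subset_tent)
  have sparse: "0 < measure Vol (T i)" "measure Vol (T i) \<le> A * measure Vol (E i)" if "i \<in> I" for i
    unfolding T_def E_def using that by (auto simp: I_def simp del: kube.simps intro!: tent_pos tent_kube)
  have slice: "{i \<in> I. fst i = l} = Pair l ` kubes (D l)" if "l \<in> {1..M}" for l
    using that by (auto simp: I_def)
  have fam: "laminar (T ` {i \<in> I. fst i = l})" "disjoint_family_on E {i \<in> I. fst i = l}" if l: "l \<in> {1..M}" for l
  proof -
    show "laminar (T ` {i \<in> I. fst i = l})"
      using lam[OF l] by (simp add: slice[OF l] image_image T_def)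
    show "disjoint_family_on E {i \<in> I. fst i = l}"
      using disjoint_kubes[OF struct[OF l] \<open>0 < \<theta>\<^sub>0\<close>] unfolding slice[OF l]
      by (auto simp: disjoint_family_on_def E_def simp del: kube.simps)
  qed
  have I: "countable I" "finite {1..M}" "\<And>i. i \<in> I \<Longrightarrow> fst i \<in> {1..M}"
    unfolding I_def by (intro countable_SIGMA countable_kubes) auto
  have kernel': "\<exists>i\<in>I. z \<in> T i \<and> w \<in> T i \<and> measure Vol (T i) \<le> A * cmod (1 - hdot z w) ^ (CARD('n) + 1)"
    if "norm z < 1" "norm w < 1" for z w
    using kernel[OF that] by (force simp: I_def T_def)
  obtain i0 where i0: "i0 \<in> I" "T i0 = unit_ball"
    using root by (force simp: I_def T_def)
  have "0 < M" using i0(1) by (auto simp: I_def)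
  have K_pos: "0 < sparse_const A p q" using A pq by (simp add: sparse_const_def)
  define C where "C = A * (real M * sparse_const A p q)"
  have "0 < C" using A K_pos \<open>0 < M\<close> by (simp add: C_def)
  have "toeplitz_defined_on u (Lp p \<sigma>) \<and> bounded_on_Lp p \<sigma> (toeplitz u) \<and>
       op_norm p \<sigma> (toeplitz u) \<le> ennreal C * ennpowr (uB_char \<theta>\<^sub>0 M D u s p \<sigma>) \<beta>"
    if u: "u \<in> Linf" and \<sigma>: "\<sigma> \<in> uB \<theta>\<^sub>0 M D u s p" for u \<sigma>
  proof -
    define \<Lambda> where "\<Lambda> = uB_char \<theta>\<^sub>0 M D u s p \<sigma>"
    have [measurable]: "u \<in> borel_measurable Vol" and u_fin: "Linf_norm unit_ball u < \<infinity>"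
      using u by (auto simp: Linf_def)
    have [measurable]: "\<sigma> \<in> borel_measurable Vol" and \<sigma>_pos: "AE z in Vol. 0 < \<sigma> z" and "\<Lambda> < \<infinity>"
      using \<sigma> by (auto simp: uB_def weight_def \<Lambda>_def)
    have \<Lambda>_ge: "ennpowr (Linf_norm (T i) u) s * avg (T i) \<sigma> * ennpowr (avg (T i) (\<lambda>z. \<sigma> z powr (1 - q))) (p - 1) \<le> \<Lambda>"
      if "i \<in> I" for i
      unfolding \<Lambda>_def uB_char_def Let_def q_def[symmetric] using that
      by (intro SUP_upper2[of i]) (auto simp: I_def T_def)
    have R_fin: "ennreal C * ennpowr \<Lambda> \<beta> < \<infinity>"
      using \<open>\<Lambda> < \<infinity>\<close> by (auto simp: ennreal_mult_less_top ennpowr_def)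
    show ?thesis unfolding \<Lambda>_def[symmetric]
    proof (cases "Linf_norm unit_ball u = 0")
      case True
      have zero: "AE w in Vol. u w = 0"
        using AE_le_Linf_norm[OF sets.top, of u] AE_space unfolding space_Vol True
        by eventually_elim simp
      show "toeplitz_defined_on u (Lp p \<sigma>) \<and> bounded_on_Lp p \<sigma> (toeplitz u) \<and>
         op_norm p \<sigma> (toeplitz u) \<le> ennreal C * ennpowr \<Lambda> \<beta>"
      proof (rule toeplitz_bounded_onI[OF _ _ _ R_fin])
        fix f assume "f \<in> Lp p \<sigma>"
        then have "f \<in> borel_measurable Vol" by (simp add: Lp_def)
        note * = toeplitz_zero_symbol[OF zero \<open>u \<in> borel_measurable Vol\<close> this]
        show "integrable Vol (toeplitz_integrand u f z)" for z by (rule *)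
        have "Lp_norm p \<sigma> (toeplitz u f) = 0"
          using pq by (simp add: Lp_norm_def *(2) ennpowr_def)
        then show "Lp_norm p \<sigma> (toeplitz u f) \<le> ennreal C * ennpowr \<Lambda> \<beta> * Lp_norm p \<sigma> f" by simp
      qed measurable
    next
      case False
      \<comment> \<open>a representative of the weight that is positive everywhere, so that its powers are exact duals\<close>
      define \<sigma>1 where "\<sigma>1 z = (if 0 < \<sigma> z then \<sigma> z else 1)" for z
      define \<tau>1 where "\<tau>1 z = \<sigma>1 z powr (1 - q)" for z
      have [measurable]: "\<sigma>1 \<in> borel_measurable Vol" "\<tau>1 \<in> borel_measurable Vol"
        unfolding \<sigma>1_def \<tau>1_def by measurable
      have \<sigma>1_pos: "0 < \<sigma>1 z" for z by (simp add: \<sigma>1_def)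
      have \<tau>1_pos: "0 < \<tau>1 z" for z using \<sigma>1_pos[of z] by (simp add: \<tau>1_def)
      have \<sigma>1: "AE z in Vol. \<sigma> z = \<sigma>1 z"
        using \<sigma>_pos by eventually_elim (simp add: \<sigma>1_def)
      then have \<tau>1: "AE z in Vol. \<sigma> z powr (1 - q) = \<tau>1 z"
        by eventually_elim (simp add: \<tau>1_def)
      \<comment> \<open>the tent equal to the whole ball has a finite product of positive factors\<close>
      have int: "integrable Vol \<sigma>1" "integrable Vol \<tau>1"
      proof -
        let ?a = "\<integral>\<^sup>+z. ennreal (\<sigma> z) \<partial>Vol" and ?b = "\<integral>\<^sup>+z. ennreal (\<sigma> z powr (1 - q)) \<partial>Vol"
        have "?a \<noteq> 0" using \<sigma>_pos by (rule nn_integral_pos_Vol) measurable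
        moreover have "?b \<noteq> 0"
          by (rule nn_integral_pos_Vol) (use \<sigma>_pos in \<open>auto elim: eventually_mono\<close>)
        moreover have "ennpowr (Linf_norm unit_ball u) s * ?a * ennpowr ?b (p - 1) < \<infinity>"
          using \<Lambda>_ge[OF i0(1)] \<open>\<Lambda> < \<infinity>\<close> unfolding i0(2) avg_ball by (rule order.strict_trans1)
        ultimately have fin: "?a < \<infinity>" "?b < \<infinity>"
          using False unfolding infinity_ennreal_def less_top[symmetric]
          by (auto simp: ennreal_mult_eq_top_iff ennpowr_eq_0_iff ennpowr_eq_top_iff)
        have "?a = (\<integral>\<^sup>+z. ennreal (\<sigma>1 z) \<partial>Vol)" "?b = (\<integral>\<^sup>+z. ennreal (\<tau>1 z) \<partial>Vol)"
          using \<sigma>1 \<tau>1 by (auto intro!: nn_integral_cong_AE elim: eventually_mono)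
        with fin show "integrable Vol \<sigma>1" "integrable Vol \<tau>1"
          using \<sigma>1_pos \<tau>1_pos by (auto intro!: integrableI_nonneg simp: less_imp_le)
      qed
      define c where "c i = enn2real (Linf_norm (T i) u)" for i
      have c_eq: "Linf_norm (T i) u = ennreal (c i)" if "i \<in> I" for i
      proof -
        have "Linf_norm (T i) u \<le> Linf_norm unit_ball u"
          using T_sets[OF that] T_sets[OF i0(1)] unfolding i0(2)
          by (rule Linf_norm_mono) (auto simp only: T_def tent_subset_ball \<open>u \<in> borel_measurable Vol\<close>)
        then have "Linf_norm (T i) u < top" using u_fin by (simp add: order.strict_trans1)
        then show ?thesis unfolding c_def by simp
      qed
      have c_nonneg: "0 \<le> c i" if "i \<in> I" for i by (simp add: c_def)
      have u_le: "AE w in Vol. w \<in> T i \<longrightarrow> cmod (u w) \<le> c i" if "i \<in> I" for i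
        using AE_le_Linf_norm[OF T_sets[OF that], of u] unfolding c_eq[OF that]
        by (auto elim!: eventually_mono simp: c_nonneg[OF that])
      define B where "B = enn2real \<Lambda>"
      have B: "0 \<le> B" "\<Lambda> = ennreal B" using \<open>\<Lambda> < \<infinity>\<close> by (auto simp: B_def)
      have B_ge: "c i powr min 1 (p - 1) * ((LINT x:T i|Vol. \<sigma>1 x) / measure Vol (T i))
          * ((LINT x:T i|Vol. \<tau>1 x) / measure Vol (T i)) powr (p - 1) \<le> B" if i: "i \<in> I" for i
      proof -
        have avgs: "avg (T i) \<sigma> = ennreal ((LINT x:T i|Vol. \<sigma>1 x) / measure Vol (T i))"
          "avg (T i) (\<lambda>z. \<sigma> z powr (1 - q)) = ennreal ((LINT x:T i|Vol. \<tau>1 x) / measure Vol (T i))"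
          using \<sigma>1_pos \<tau>1_pos int sparse(1)[OF i] T_sets[OF i]
          by (auto intro!: avg_eq \<sigma>1 \<tau>1 simp: less_imp_le)
        have nn: "0 \<le> (LINT x:T i|Vol. \<sigma>1 x) / measure Vol (T i)" "0 \<le> (LINT x:T i|Vol. \<tau>1 x) / measure Vol (T i)"
          using \<sigma>1_pos \<tau>1_pos by (auto intro!: divide_nonneg_nonneg set_integral_nonneg_all simp: less_imp_le)
        show ?thesis
          using \<Lambda>_ge[OF i] nn B(1) c_nonneg[OF i]
          unfolding c_eq[OF i] avgs B(2) s_def[symmetric]
          by (simp add: ennpowr_ennreal ennreal_mult[symmetric] del: times_divide_eq_right times_divide_eq_left)
      qed
      show "toeplitz_defined_on u (Lp p \<sigma>) \<and> bounded_on_Lp p \<sigma> (toeplitz u) \<and>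
         op_norm p \<sigma> (toeplitz u) \<le> ennreal C * ennpowr \<Lambda> \<beta>"
      proof (rule toeplitz_bounded_onI[OF _ _ _ R_fin])
        fix f assume f: "f \<in> Lp p \<sigma>"
        then have [measurable]: "f \<in> borel_measurable Vol" and "Lp_norm p \<sigma> f < \<infinity>" by (auto simp: Lp_def)
        have cong: "(\<integral>\<^sup>+z. ennreal (cmod (h z) powr p * \<sigma> z) \<partial>Vol) = (\<integral>\<^sup>+z. ennreal (cmod (h z) powr p * \<sigma>1 z) \<partial>Vol)" for h
          using \<sigma>1 by (intro nn_integral_cong_AE) (auto elim: eventually_mono)
        have Lp_norm_eq: "Lp_norm p \<sigma> h = ennpowr (\<integral>\<^sup>+z. ennreal (cmod (h z) powr p * \<sigma>1 z) \<partial>Vol) (1 / p)" for h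
          by (simp add: Lp_norm_def cong)
        have "(\<integral>\<^sup>+z. ennreal (cmod (f z) powr p * \<sigma>1 z) \<partial>Vol) < \<infinity>"
          using \<open>Lp_norm p \<sigma> f < \<infinity>\<close> unfolding Lp_norm_eq infinity_ennreal_def less_top[symmetric] ennpowr_eq_top_iff .
        then have fp: "integrable Vol (\<lambda>z. cmod (f z) powr p * \<sigma>1 z)"
          using \<sigma>1_pos by (intro integrableI_nonneg) (auto simp: less_imp_le)
        define Y where "Y = (LINT z|Vol. cmod (f z) powr p * \<sigma>1 z)"
        have "0 \<le> Y" unfolding Y_def using \<sigma>1_pos by (intro integral_nonneg_AE) (auto simp: less_imp_le)
        have norm_f: "Lp_norm p \<sigma> f = ennreal (Y powr (1 / p))"
          using fp \<sigma>1_pos \<open>0 \<le> Y\<close> unfolding Lp_norm_eq Y_def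
          by (subst nn_integral_eq_integral) (auto simp: less_imp_le ennpowr_ennreal)
        have dual: "\<sigma>1 z powr (1 / p) * \<tau>1 z powr (1 / q) = 1" for z
        proof -
          have "1 / p + (1 - q) * (1 / q) = 0" using pq by (simp add: field_simps)
          then show ?thesis using \<sigma>1_pos[of z] by (simp add: \<tau>1_def powr_powr powr_add[symmetric])
        qed
        have "integrable Vol (\<lambda>z. cmod (f z))"
          by (rule integrable_of_weighted_Lp[OF pq _ less_imp_le[OF \<sigma>1_pos] int(2)
                less_imp_le[OF \<tau>1_pos] dual _ norm_ge_zero fp]) measurable
        then have f_int: "integrable Vol f" by (rule integrable_norm_cancel) measurable
        have T_int: "integrable Vol (toeplitz_integrand u f z)" if "norm z < 1" for z
        proof (rule toeplitz_integrable[OF _ f_int _ that])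
          show "AE w in Vol. cmod (u w) \<le> c i0"
            using u_le[OF i0(1)] AE_space unfolding i0(2) space_Vol by eventually_elim simp
        qed measurable
        then show "norm z < 1 \<Longrightarrow> integrable Vol (toeplitz_integrand u f z)" for z .
        let ?N = "A * (real (card {1..M}) * sparse_const A p q * B powr \<beta> * Y powr (1 / p))"
        have "(\<integral>\<^sup>+z. ennreal (cmod (toeplitz u f z) powr p * \<sigma>1 z) \<partial>Vol) \<le> ennreal (?N powr p)"
          unfolding Y_def \<beta>_def
          by (rule toeplitz_weighted_bound[OF pq I fam T_sets E_sets E_sub sparse kernel' int(1) \<sigma>1_pos int(2) \<tau>1_def
              c_nonneg A B_ge B(1) _ u_le _ f_int fp T_int]) measurable
        then have "Lp_norm p \<sigma> (toeplitz u f) \<le> ennpowr (ennreal (?N powr p)) (1 / p)"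
          unfolding Lp_norm_eq using pq by (intro ennpowr_mono) auto
        also have "\<dots> = ennreal ?N"
          using A K_pos pq by (simp add: ennpowr_ennreal powr_powr)
        also have "?N = C * B powr \<beta> * Y powr (1 / p)" by (simp add: C_def)
        also have "ennreal \<dots> = ennreal C * ennpowr \<Lambda> \<beta> * Lp_norm p \<sigma> f"
          using \<open>0 < C\<close> B by (simp add: norm_f ennpowr_ennreal ennreal_mult)
        finally show "Lp_norm p \<sigma> (toeplitz u f) \<le> ennreal C * ennpowr \<Lambda> \<beta> * Lp_norm p \<sigma> f" .
      qed measurable
    qed
  qed
  then show ?thesis
    using \<open>0 < C\<close> unfolding s_def \<beta>_def by blast
qed

end
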